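(* Let $\mathcal{A}\in\mathbb{R}^{n\times n\times p}$ be T-SPD, $d=np\ge 2$, with T-eigenvalues $\lambda_1>\lambda_2\ge\cdots\ge\lambda_d>0$, and let $\gamma=1-\lambda_2/\lambda_1$. Let $\hat\lambda_1^{\rm pow}$ be the Rayleigh quotient produced by the T-product randomized power method after $q\ge 1$ iterations, and let $\hat\lambda_1^{\rm TDep}:=m+s\sqrt{d-1}$. Then there is a universal constant $0<c\le 0.824$ (independent of $\mathcal{A},d,q,\delta$; it may be taken to be any such constant for which, for all $d\ge 2$, all $\delta\in(0,1)$ and any fixed unit vector $\mathbf{v}_1\in\mathbb{R}^d$, a uniformly random unit vector in $\mathbb{R}^d$ makes an angle $\theta_0\in[0,\pi/2]$ with the line spanned by $\mathbf{v}_1$ satisfying $\tan^2\theta_0\le c^2d/\delta^2$ with probability at least $1-\delta$) such that for every $\delta\in(0,1)$, with probability at least $1-\delta$ over the draw of the initial vector $\mathbf{x}_0$, $$\hat\lambda_1^{\rm TDep}-\hat\lambda_1^{\rm pow}\;\le\;\left(s\sqrt{d-1}-\frac{s}{\sqrt{d-1}}\right)+\frac{c^2 d\,\lambda_1}{\delta^2}(1-\gamma)^{2q}.$$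
   Context: For $\mathcal{A}\in\mathbb{R}^{n\times n\times p}$ with frontal slices $\mathcal{A}^{(1)},\dots,\mathcal{A}^{(p)}\in\mathbb{R}^{n\times n}$, $\operatorname{bcirc}(\mathcal{A})\in\mathbb{R}^{np\times np}$ is the block circulant matrix whose $(i,j)$ block ($1\le i,j\le p$) is $\mathcal{A}^{(((i-j)\bmod p)+1)}$. The tensor $\mathcal{A}$ is T-SPD if $\operatorname{bcirc}(\mathcal{A})$ is symmetric positive definite. The T-eigenvalues of $\mathcal{A}$ are the eigenvalues of $\operatorname{bcirc}(\mathcal{A})$, counted with multiplicity. The mean and standard deviation of the spectrum are $m=\frac1d\sum_{i=1}^d\lambda_i$ and $s=\bigl(\frac1d\sum_{i=1}^d\lambda_i^2-m^2\bigr)^{1/2}\ge 0$. T-product randomized power method with $q$ iterations: draw $\mathbf{x}_0\sim\mathcal{N}(0,I_d)$ and normalize it to unit Euclidean norm; for $k=1,\dots,q$ set $\mathbf{y}_k=\operatorname{bcirc}(\mathcal{A})\mathbf{x}_{k-1}$ and $\mathbf{x}_k=\mathbf{y}_k/\|\mathbf{y}_k\|_2$; output $\hat\lambda_1^{\rm pow}=\mathbf{x}_q^{\mathsf T}\operatorname{bcirc}(\mathcal{A})\mathbf{x}_q$. *)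

theory Defs
  imports "HOL-Probability.Probability" "Jordan_Normal_Form.Char_Poly"
begin

unbundle no inner_syntax
no_notation Finite_Cartesian_Product.vec_nth (infixl \<open>$\<close> 90)
hide_const (open) Finite_Cartesian_Product.vec
hide_type (open) Finite_Cartesian_Product.vec

text \<open>A tensor in \<open>R^(n * n * p)\<close> is given by its frontal slices \<open>A 1, ..., A p\<close>, each an
  \<open>n * n\<close> matrix.\<close>

definition is_tensor :: "nat \<Rightarrow> nat \<Rightarrow> (nat \<Rightarrow> real mat) \<Rightarrow> bool" where
  "is_tensor n p A \<longleftrightarrow> (\<forall>k\<in>{1..p}. A k \<in> carrier_mat n n)"

text \<open>Rows and columns are counted from 0, so row \<open>i\<close> lies in block row \<open>i div n\<close>. The difference
  of block indices is taken in the integers because it can be negative.\<close>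

definition bcirc :: "nat \<Rightarrow> nat \<Rightarrow> (nat \<Rightarrow> real mat) \<Rightarrow> real mat" where
  "bcirc n p A = mat (n * p) (n * p) (\<lambda>(i, j).
     A (nat ((int (i div n) - int (j div n)) mod int p) + 1) $$ (i mod n, j mod n))"

definition sym_pos_def :: "real mat \<Rightarrow> bool" where
  "sym_pos_def M \<longleftrightarrow> M\<^sup>T = M \<and>
     (\<forall>x\<in>carrier_vec (dim_row M). x \<noteq> 0\<^sub>v (dim_row M) \<longrightarrow> 0 < x \<bullet> (M *\<^sub>v x))"

definition T_SPD :: "nat \<Rightarrow> nat \<Rightarrow> (nat \<Rightarrow> real mat) \<Rightarrow> bool" where
  "T_SPD n p A \<longleftrightarrow> is_tensor n p A \<and> sym_pos_def (bcirc n p A)"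

definition T_eigenvalues :: "nat \<Rightarrow> nat \<Rightarrow> (nat \<Rightarrow> real mat) \<Rightarrow> real multiset" where
  "T_eigenvalues n p A = proots (char_poly (bcirc n p A))"

definition spec_mean :: "nat \<Rightarrow> (nat \<Rightarrow> real) \<Rightarrow> real" where
  "spec_mean d l = (\<Sum>i=1..d. l i) / real d"

definition spec_sd :: "nat \<Rightarrow> (nat \<Rightarrow> real) \<Rightarrow> real" where
  "spec_sd d l = sqrt ((\<Sum>i=1..d. (l i)\<^sup>2) / real d - (spec_mean d l)\<^sup>2)"

definition lambda_TDep :: "nat \<Rightarrow> (nat \<Rightarrow> real) \<Rightarrow> real" where
  "lambda_TDep d l = spec_mean d l + spec_sd d l * sqrt (real d - 1)"

definition vnorm :: "real vec \<Rightarrow> real" where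
  "vnorm x = sqrt (x \<bullet> x)"

definition vnormalize :: "real vec \<Rightarrow> real vec" where
  "vnormalize x = (1 / vnorm x) \<cdot>\<^sub>v x"

text \<open>The first argument is the matrix, the last one the draw before normalization.\<close>

primrec power_iterate :: "real mat \<Rightarrow> nat \<Rightarrow> real vec \<Rightarrow> real vec" where
  "power_iterate M 0 x = vnormalize x"
| "power_iterate M (Suc k) x = vnormalize (M *\<^sub>v power_iterate M k x)"

definition lambda_pow :: "nat \<Rightarrow> nat \<Rightarrow> (nat \<Rightarrow> real mat) \<Rightarrow> nat \<Rightarrow> real vec \<Rightarrow> real" where
  "lambda_pow n p A q x =
     power_iterate (bcirc n p A) q x \<bullet> (bcirc n p A *\<^sub>v power_iterate (bcirc n p A) q x)"

text \<open>Lebesgue measure on vectors of dimension \<open>d\<close>, transported along the bijection \<open>vec d\<close>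
  from extensional functions on \<open>{..<d}\<close>.\<close>

definition lborel_vec :: "nat \<Rightarrow> real vec measure" where
  "lborel_vec d = embed_measure (\<Pi>\<^sub>M i\<in>{..<d}. lborel) (vec d)"

definition std_gaussian :: "nat \<Rightarrow> real vec measure" where
  "std_gaussian d = density (lborel_vec d) (\<lambda>x. ennreal (\<Prod>i<d. std_normal_density (x $ i)))"

text \<open>The uniform distribution on the unit sphere is the radial projection of the uniform
  distribution on the unit ball, so a set has the volume of the cone over it as its measure.\<close>

definition uniform_sphere :: "nat \<Rightarrow> real vec measure" where
  "uniform_sphere d =
     distr (uniform_measure (lborel_vec d) {x \<in> carrier_vec d. vnorm x \<le> 1})
       (lborel_vec d) vnormalize"

definition line_angle :: "real vec \<Rightarrow> real vec \<Rightarrow> real" where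
  "line_angle v x = arccos (\<bar>v \<bullet> x\<bar> / (vnorm v * vnorm x))"

text \<open>The right angle is excluded explicitly: its tangent is infinite, but 0 in HOL.\<close>

definition angle_constant :: "real \<Rightarrow> bool" where
  "angle_constant c \<longleftrightarrow>
     (\<forall>d\<ge>2. \<forall>\<delta>\<in>{0<..<1}. \<forall>v\<in>carrier_vec d. vnorm v = 1 \<longrightarrow>
        \<P>(x in uniform_sphere d. line_angle v x \<noteq> pi / 2 \<and>
            (tan (line_angle v x))\<^sup>2 \<le> c\<^sup>2 * real d / \<delta>\<^sup>2) \<ge> 1 - \<delta>)"

end

(* In an orthonormal eigenbasis of bcirc(A) with top eigenvector v, the power iterate is a positive
   multiple of (lambda_i^q a_i)_i, where a_i are the coordinates of the initial vector x. Hence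
   lambda_1 - pow <= lambda_1 (lambda_2 / lambda_1)^(2q) tan^2 theta, theta being the angle of x with
   the line of v, while Samuelson's inequality gives m + s / sqrt(d-1) <= lambda_1.

   The event tan^2 theta <= kappa is a cone, so the standard Gaussian and the uniform distribution on
   the sphere give it the same probability. Under the Gaussian v may be rotated to a coordinate axis;
   the complement then says that one standard normal coordinate is at most 1 / sqrt kappa times the
   norm of the other d - 1, which has probability at most sqrt (2 / pi) sqrt (d-1) / sqrt kappa. *)

theory Submission
  imports Defs "Jordan_Normal_Form.Schur_Decomposition"
begin

section \<open>Power iteration in an orthonormal eigenbasis\<close>

text \<open>All sets and densities that have to be integrated depend on \<open>x\<close> only
  through the pair \<open>v \<bullet> x\<close>, \<open>x \<bullet> x\<close>. Rotation and dilation
  invariance of Lebesgue measure are therefore proved only for functions of such a pair, by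
  induction on the dimension with Fubini and one-dimensional affine substitutions; neither
  determinants of general linear maps nor a surface measure on the sphere occur. On the algebraic
  side the spectrum is given as a multiset of \<open>d\<close> real roots of the characteristic
  polynomial. Diagonalization deflates along a list of these roots and respects its order, which
  puts the simple top eigenvalue at coordinate 0.\<close>

lemma orthogonal_mat_with_first_col:
  fixes v :: "real vec"
  assumes v: "v \<in> carrier_vec n" and v0: "v \<noteq> 0\<^sub>v n"
  obtains W a where "W \<in> carrier_mat n n" "W\<^sup>T * W = 1\<^sub>m n" "W * W\<^sup>T = 1\<^sub>m n" "col W 0 = a \<cdot>\<^sub>v v"
proof -
  interpret cof_vec_space n "TYPE(real)" .
  define b where "b = basis_completion v"
  define ws where "ws = gram_schmidt n b"
  from basis_completion[OF v v0, folded b_def]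
  have dist_b: "distinct b" and indep: "\<not> lin_dep (set b)" and b: "set b \<subseteq> carrier_vec n"
    and hdb: "hd b = v" and len_b: "length b = n" by auto
  have n: "n \<noteq> 0"
  proof
    assume "n = 0" with v v0 show False by (auto simp: zero_vec_def)
  qed
  from hdb len_b n obtain vs where bv: "b = v # vs" by (cases b, auto)
  from gram_schmidt_result[OF b dist_b indep refl, folded ws_def]
  have ws: "set ws \<subseteq> carrier_vec n" "corthogonal ws" "length ws = n"
    by (auto simp: len_b)
  from gram_schmidt_hd[OF v, of vs, folded bv] have hdws: "hd ws = v" unfolding ws_def .
  have wsi: "ws ! i \<in> carrier_vec n" if "i < n" for i using ws that by auto
  have orth: "(ws ! i \<bullet> ws ! j = 0) = (i \<noteq> j)" if "i < n" "j < n" for i j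
    using corthogonalD[OF ws(2), of i j] that ws(3) by simp
  have pos: "0 < ws ! i \<bullet> ws ! i" if "i < n" for i
  proof -
    have "0 \<le> ws ! i \<bullet> ws ! i" by (simp add: scalar_prod_def sum_nonneg)
    with orth[OF that that] show ?thesis by linarith
  qed
  \<comment> \<open>Gram-Schmidt yields orthogonal vectors that are not normalized. Its head is
    still \<open>v\<close>, so after this scaling column 0 is a multiple of
    \<open>v\<close>.\<close>
  define c where "c i = 1 / sqrt (ws ! i \<bullet> ws ! i)" for i
  define W where "W = mat_of_cols n (map (\<lambda>i. c i \<cdot>\<^sub>v ws ! i) [0..<n])"
  have W: "W \<in> carrier_mat n n" by (simp add: W_def mat_of_cols_def)
  have col: "col W i = c i \<cdot>\<^sub>v ws ! i" if "i < n" for i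
    unfolding W_def using that wsi by (subst col_mat_of_cols) auto
  have WW: "W\<^sup>T * W = 1\<^sub>m n"
  proof (rule eq_matI)
    fix i j assume "i < dim_row (1\<^sub>m n)" "j < dim_col (1\<^sub>m n :: real mat)"
    then have ij: "i < n" "j < n" by auto
    have "(W\<^sup>T * W) $$ (i, j) = c i * c j * (ws ! i \<bullet> ws ! j)"
      using ij W wsi[of i] wsi[of j] by (simp add: col row_transpose smult_scalar_prod_distrib[of _ n] scalar_prod_smult_distrib[of _ n])
    also have "\<dots> = (if i = j then 1 else 0)"
      using orth[OF ij] pos[OF ij(1)] by (auto simp: c_def)
    finally show "(W\<^sup>T * W) $$ (i, j) = 1\<^sub>m n $$ (i, j)" using ij by simp
  qed (use W in auto)
  have WW': "W * W\<^sup>T = 1\<^sub>m n" using mat_mult_left_right_inverse[OF _ W WW] W by auto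
  have "col W 0 = c 0 \<cdot>\<^sub>v v" using col[of 0] n hdws ws(3) by (cases ws) auto
  from that[OF W WW WW' this] show thesis .
qed

text \<open>Deflation: an orthogonal change of basis whose first column is an eigenvector for
  \<open>e\<close> turns \<open>A\<close> into a symmetric matrix with first column \<open>e\<close>
  times the first unit vector. By symmetry the first row has the same shape, and a symmetric block
  of size \<open>n - 1\<close> with the remaining linear factors is left. Roots are removed in list
  order, hence column \<open>i\<close> belongs to \<open>es ! i\<close>.\<close>

lemma orthogonal_diagonalization:
  fixes A :: "real mat"
  assumes "A \<in> carrier_mat n n" "A\<^sup>T = A" "char_poly A = (\<Prod>e\<leftarrow>es. [:- e, 1:])"
  shows "\<exists>U\<in>carrier_mat n n. U\<^sup>T * U = 1\<^sub>m n \<and> A * U = U * mat_diag n (\<lambda>i. es ! i)"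
  using assms
proof (induction es arbitrary: n A)
  case Nil
  with degree_monic_char_poly[of A n] have "n = 0" by auto
  with Nil show ?case by (intro bexI[of _ "1\<^sub>m 0"]) (auto intro!: eq_matI simp: mat_diag_def)
next
  case (Cons e es n A)
  let ?n1 = "n - 1"
  note A = Cons.prems(1) and sym = Cons.prems(2)
  have cp: "char_poly A = [:-e, 1:] * (\<Prod>e\<leftarrow>es. [:- e, 1:])" using Cons.prems by simp
  have mon: "monic (\<Prod>e\<leftarrow>es. [:- e, 1:])" by (rule monic_prod_list, auto)
  have deg: "degree (char_poly A) = Suc (degree (\<Prod>e\<leftarrow>es. [:- e, 1:]))" unfolding cp
    by (subst degree_mult_eq, insert mon, auto)
  with degree_monic_char_poly[OF A] have n: "n \<noteq> 0" by auto
  then have n1: "1 + ?n1 = n" by simp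
  have "eigenvalue A e" unfolding eigenvalue_root_char_poly[OF A] cp by simp
  then obtain v where "eigenvector A v e" unfolding eigenvalue_def by auto
  then have v: "v \<in> carrier_vec n" "v \<noteq> 0\<^sub>v n" and Av: "A *\<^sub>v v = e \<cdot>\<^sub>v v"
    using A by (auto simp: eigenvector_def)
  obtain W a where W: "W \<in> carrier_mat n n" and WW: "W\<^sup>T * W = 1\<^sub>m n" "W * W\<^sup>T = 1\<^sub>m n"
    and cW: "col W 0 = a \<cdot>\<^sub>v v"
    using orthogonal_mat_with_first_col[OF v] .
  define A' where "A' = W\<^sup>T * A * W"
  have A': "A' \<in> carrier_mat n n" using A W unfolding A'_def by auto
  have symA': "A'\<^sup>T = A'"
  proof -
    have "A'\<^sup>T = W\<^sup>T * (A\<^sup>T * W)" unfolding A'_def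
      by (subst transpose_mult[of _ n n _ n], use A W in auto, subst transpose_mult[of _ n n _ n], use A W in auto)
    then show ?thesis unfolding A'_def sym using A W by (simp add: assoc_mult_mat[of _ n n _ n _ n])
  qed
  have sim: "similar_mat A' A"
    unfolding similar_mat_def
    by (intro exI, rule similar_mat_witI[of "W\<^sup>T" W n A' A]) (use A A' W WW in \<open>auto simp: A'_def\<close>)
  have WA': "W * A' = A * W"
  proof -
    have "W * A' = (W * W\<^sup>T) * (A * W)"
      unfolding A'_def using A W by (simp add: assoc_mult_mat[of _ n n _ n _ n])
    then show ?thesis using WW A W by simp
  qed
  have A'0: "A' $$ (i, 0) = (if i = 0 then e else 0)" if i: "i < n" for i
  proof -
    have "A' = W\<^sup>T * (A * W)" unfolding A'_def using A W by (simp add: assoc_mult_mat[of _ n n _ n _ n])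
    then have "A' $$ (i, 0) = row (W\<^sup>T) i \<bullet> col (A * W) 0" using i n W A by simp
    also have "col (A * W) 0 = A *\<^sub>v col W 0" using col_mult2[OF A W, of 0] n by simp
    also have "\<dots> = e \<cdot>\<^sub>v col W 0" unfolding cW using A v Av
      by (simp add: mult_mat_vec smult_smult_assoc mult.commute)
    also have "row (W\<^sup>T) i \<bullet> (e \<cdot>\<^sub>v col W 0) = e * (W\<^sup>T * W) $$ (i, 0)"
      using i n W by (simp add: row_transpose)
    finally show ?thesis using WW i n by auto
  qed
  have A'0r: "A' $$ (0, i) = (if i = 0 then e else 0)" if i: "i < n" for i
    using A'0[OF i] symA' i n A' by (metis carrier_matD index_transpose_mat(1) neq0_conv)
  define A3 where "A3 = mat ?n1 ?n1 (\<lambda>(i, j). A' $$ (Suc i, Suc j))"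
  define E where "E = mat 1 1 (\<lambda>_. e)"
  have E: "E \<in> carrier_mat 1 1" by (simp add: E_def)
  have A3: "A3 \<in> carrier_mat ?n1 ?n1" by (simp add: A3_def)
  have A'b: "A' = four_block_mat E (0\<^sub>m 1 ?n1) (0\<^sub>m ?n1 1) A3"
  proof (rule eq_matI)
    fix i j
    assume "i < dim_row (four_block_mat E (0\<^sub>m 1 ?n1) (0\<^sub>m ?n1 1) A3)"
      "j < dim_col (four_block_mat E (0\<^sub>m 1 ?n1) (0\<^sub>m ?n1 1) A3)"
    then have "i < n" "j < n" using E A3 n by auto
    then show "A' $$ (i, j) = four_block_mat E (0\<^sub>m 1 ?n1) (0\<^sub>m ?n1 1) A3 $$ (i, j)"
      using E A3 n by (cases i; cases j) (auto simp: A'0 A'0r A3_def E_def)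
  qed (use A' E A3 n in auto)
  have symA3: "A3\<^sup>T = A3"
  proof (rule eq_matI)
    fix i j assume "i < dim_row A3" "j < dim_col A3"
    then have ij: "Suc i < n" "Suc j < n" using A3 by auto
    have "A' $$ (Suc j, Suc i) = A' $$ (Suc i, Suc j)"
      using symA' ij A' by (metis carrier_matD index_transpose_mat(1))
    then show "A3\<^sup>T $$ (i, j) = A3 $$ (i, j)" using ij by (simp add: A3_def)
  qed (use A3 in auto)
  have "[:-e, 1:] * (\<Prod>e\<leftarrow>es. [:- e, 1:]) = char_poly A'"
    using char_poly_similar[OF sim] cp by simp
  also have "\<dots> = char_poly E * char_poly A3"
    unfolding A'b by (rule char_poly_four_block_zeros_col[OF E _ A3]) auto
  also have "char_poly E = [:-e, 1:]" by (simp add: E_def char_poly_defs det_def sign_def)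
  finally have "char_poly A3 = (\<Prod>e\<leftarrow>es. [:- e, 1:])"
    by (metis mult_cancel_left pCons_eq_0_iff zero_neq_one)
  from Cons.IH[OF A3 symA3 this] obtain U' where U': "U' \<in> carrier_mat ?n1 ?n1"
    and UU': "U'\<^sup>T * U' = 1\<^sub>m ?n1" and AU': "A3 * U' = U' * mat_diag ?n1 (\<lambda>i. es ! i)" by auto
  define B where "B = four_block_mat (1\<^sub>m 1) (0\<^sub>m 1 ?n1) (0\<^sub>m ?n1 1) U'"
  have B: "B \<in> carrier_mat n n" unfolding B_def using U' n1 by (metis four_block_carrier_mat one_carrier_mat)
  have D: "mat_diag n (\<lambda>i. (e # es) ! i) =
    four_block_mat E (0\<^sub>m 1 ?n1) (0\<^sub>m ?n1 1) (mat_diag ?n1 (\<lambda>i. es ! i))"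
    by (rule eq_matI) (use n in \<open>auto simp: mat_diag_def E_def nth_Cons'\<close>)
  have BB: "B\<^sup>T * B = 1\<^sub>m n"
  proof -
    have "B\<^sup>T = four_block_mat (1\<^sub>m 1) (0\<^sub>m 1 ?n1) (0\<^sub>m ?n1 1) (U'\<^sup>T)"
      unfolding B_def by (subst transpose_four_block_mat[of _ 1 1 _ ?n1 _ ?n1]) (use U' in auto)
    then have "B\<^sup>T * B = four_block_mat (1\<^sub>m 1) (0\<^sub>m 1 ?n1) (0\<^sub>m ?n1 1) (1\<^sub>m ?n1)"
      unfolding B_def using U' UU' by (simp add: mult_four_block_mat[of _ 1 1 _ ?n1 _ ?n1 _ _ 1 _ ?n1])
    also have "\<dots> = 1\<^sub>m n" by (rule eq_matI) (use n in auto)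
    finally show ?thesis .
  qed
  have A'B: "A' * B = B * mat_diag n (\<lambda>i. (e # es) ! i)"
    unfolding A'b B_def D using U' E A3 AU'
    by (simp add: left_mult_zero_mat[OF mat_diag_dim] mult_four_block_mat[of _ 1 1 _ ?n1 _ ?n1 _ _ 1 _ ?n1])
  show ?case
  proof (intro bexI conjI)
    show "W * B \<in> carrier_mat n n" using W B by simp
    have "(W * B)\<^sup>T * (W * B) = B\<^sup>T * ((W\<^sup>T * W) * B)"
      using W B by (simp add: transpose_mult[of _ n n _ n] assoc_mult_mat[of _ n n _ n _ n])
    then show "(W * B)\<^sup>T * (W * B) = 1\<^sub>m n" using WW BB B by simp
    have "A * (W * B) = (A * W) * B" using A W B by simp
    also have "\<dots> = W * (A' * B)" unfolding WA'[symmetric] using W A' B by simp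
    also have "\<dots> = W * B * mat_diag n (\<lambda>i. (e # es) ! i)" unfolding A'B
      by (rule assoc_mult_mat[OF W B mat_diag_dim, symmetric])
    finally show "A * (W * B) = W * B * mat_diag n (\<lambda>i. (e # es) ! i)" .
  qed
qed

text \<open>\<open>proots\<close> counts real roots with multiplicity. A list of \<open>d\<close> of
  them exhausts the degree, so the product of their linear factors divides the characteristic
  polynomial with a monic constant as quotient.\<close>

lemma char_poly_splits:
  fixes M :: "real mat"
  assumes M: "M \<in> carrier_mat d d" and roots: "proots (char_poly M) = mset es" and len: "length es = d"
  shows "char_poly M = (\<Prod>e\<leftarrow>es. [:- e, 1:])"
proof -
  let ?q = "\<lambda>es. \<Prod>e\<leftarrow>es. [:- e, 1:] :: real poly"
  have mon: "monic (char_poly M)" and deg: "degree (char_poly M) = d"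
    using degree_monic_char_poly[OF M] by auto
  have "\<exists>r. p = ?q xs * r" if "mset xs \<subseteq># proots p" "p \<noteq> 0" for xs and p :: "real poly"
    using that
  proof (induction xs arbitrary: p)
    case (Cons x xs)
    then have "x \<in># proots p" by (simp add: insert_subset_eq_iff)
    then have "poly p x = 0" using Cons.prems(2) by simp
    then obtain p' where p': "p = [:-x, 1:] * p'" by (auto simp: poly_eq_0_iff_dvd dvd_def)
    with Cons.prems have "p' \<noteq> 0" by auto
    with p' have "proots p = {#x#} + proots p'" by (simp add: proots_mult del: mult_pCons_left)
    with Cons.prems have "mset xs \<subseteq># proots p'" by simp
    from Cons.IH[OF this \<open>p' \<noteq> 0\<close>] obtain r where "p' = ?q xs * r" by auto
    with p' show ?case by (auto simp: mult.assoc simp del: mult_pCons_left)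
  qed simp
  from this[of es "char_poly M"] roots mon obtain r where r: "char_poly M = ?q es * r" by fastforce
  have q: "monic (?q es)" by (rule monic_prod_list) auto
  have degq: "degree (?q xs) = length xs" for xs
  proof (induction xs)
    case (Cons x xs)
    have "monic (?q xs)" by (rule monic_prod_list) auto
    then have "?q xs \<noteq> 0" by auto
    then show ?case using Cons by (simp add: degree_mult_eq del: mult_pCons_left)
  qed simp
  have r0: "r \<noteq> 0" using r mon by auto
  then have "degree r = 0" using r deg degq[of es] len q by (metis degree_mult_eq add_cancel_right_right leading_coeff_0_iff zero_neq_one)
  moreover have "lead_coeff r = 1" using r mon q by (metis lead_coeff_mult mult_1)
  ultimately have "r = 1" by (metis monic_degree_0)
  with r show ?thesis by simp
qed

text \<open>The later estimates live in the coordinates \<open>u i \<bullet> x\<close>.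
  \<open>u_mult\<close> is the eigenvector equation moved to the other factor by the symmetry of
  \<open>M\<close>: in these coordinates \<open>M\<close> acts diagonally.\<close>

locale orthonormal_eigenbasis =
  fixes d :: nat and M :: "real mat" and u :: "nat \<Rightarrow> real vec" and \<mu> :: "nat \<Rightarrow> real"
  assumes M: "M \<in> carrier_mat d d"
    and u: "i < d \<Longrightarrow> u i \<in> carrier_vec d"
    and parseval: "x \<in> carrier_vec d \<Longrightarrow> y \<in> carrier_vec d \<Longrightarrow>
          x \<bullet> y = (\<Sum>i<d. (u i \<bullet> x) * (u i \<bullet> y))"
    and u_unit: "i < d \<Longrightarrow> u i \<bullet> u i = 1"
    and u_mult: "i < d \<Longrightarrow> x \<in> carrier_vec d \<Longrightarrow> u i \<bullet> (M *\<^sub>v x) = \<mu> i * (u i \<bullet> x)"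

lemma symmetric_has_orthonormal_eigenbasis:
  fixes M :: "real mat"
  assumes M: "M \<in> carrier_mat d d" and sym: "M\<^sup>T = M"
    and roots: "proots (char_poly M) = mset es" and len: "length es = d"
  shows "\<exists>u. orthonormal_eigenbasis d M u (\<lambda>i. es ! i)"
proof -
  obtain U where U: "U \<in> carrier_mat d d" and UU: "U\<^sup>T * U = 1\<^sub>m d"
    and MU: "M * U = U * mat_diag d (\<lambda>i. es ! i)"
    using orthogonal_diagonalization[OF M sym char_poly_splits[OF M roots len]] by auto
  have UU': "U * U\<^sup>T = 1\<^sub>m d" using mat_mult_left_right_inverse[OF _ U UU] U by auto
  have coef: "col U i \<bullet> x = (U\<^sup>T *\<^sub>v x) $ i" if "i < d" for i x
    using that U by (simp add: row_transpose)
  have ut: "U\<^sup>T *\<^sub>v (M *\<^sub>v x) = mat_diag d (\<lambda>i. es ! i) *\<^sub>v (U\<^sup>T *\<^sub>v x)" if x: "x \<in> carrier_vec d" for x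
  proof -
    \<comment> \<open>Transposing the diagonalization, with \<open>M\<close> symmetric, makes the
      columns of \<open>U\<close> left eigenvectors.\<close>
    have "U\<^sup>T * M = (M * U)\<^sup>T" using U M sym by (simp add: transpose_mult[of _ d d _ d])
    also have "\<dots> = (mat_diag d (\<lambda>i. es ! i))\<^sup>T * U\<^sup>T"
      unfolding MU using U by (simp add: transpose_mult[of _ d d _ d])
    also have "(mat_diag d (\<lambda>i. es ! i))\<^sup>T = mat_diag d (\<lambda>i. es ! i)"
      by (rule eq_matI) (auto simp: mat_diag_def)
    finally have "U\<^sup>T * M = mat_diag d (\<lambda>i. es ! i) * U\<^sup>T" .
    then show ?thesis using x U M
      by (metis assoc_mult_mat_vec mat_diag_dim transpose_carrier_mat)
  qed
  have "orthonormal_eigenbasis d M (col U) (\<lambda>i. es ! i)"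
  proof
    show "M \<in> carrier_mat d d" by fact
    show "col U i \<in> carrier_vec d" if "i < d" for i using U that by auto
    fix x y :: "real vec" assume x: "x \<in> carrier_vec d" and y: "y \<in> carrier_vec d"
    have "x \<bullet> y = x \<bullet> (U *\<^sub>v (U\<^sup>T *\<^sub>v y))"
      using UU' y U by (subst assoc_mult_mat_vec[symmetric, of _ d d _ d]) auto
    also have "\<dots> = (U\<^sup>T *\<^sub>v x) \<bullet> (U\<^sup>T *\<^sub>v y)"
      using transpose_vec_mult_scalar[of U d d "U\<^sup>T *\<^sub>v y" x] U x y by auto
    also have "\<dots> = (\<Sum>i<d. (col U i \<bullet> x) * (col U i \<bullet> y))"
      using U by (simp add: scalar_prod_def[of "U\<^sup>T *\<^sub>v x"] atLeast0LessThan row_transpose)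
    finally show "x \<bullet> y = (\<Sum>i<d. (col U i \<bullet> x) * (col U i \<bullet> y))" .
  next
    fix i assume i: "i < d"
    have "col U i \<bullet> col U i = (U\<^sup>T * U) $$ (i, i)" using i U by (simp add: row_transpose)
    then show "col U i \<bullet> col U i = 1" using UU i by simp
  next
    fix i and x :: "real vec" assume i: "i < d" and x: "x \<in> carrier_vec d"
    have "col U i \<bullet> (M *\<^sub>v x) = (mat_diag d (\<lambda>i. es ! i) *\<^sub>v (U\<^sup>T *\<^sub>v x)) $ i"
      using coef[OF i] ut[OF x] by simp
    also have "\<dots> = (\<Sum>j<d. (if i = j then es ! j else 0) * (U\<^sup>T *\<^sub>v x) $ j)"
      using i U by (simp add: scalar_prod_def mat_diag_def atLeast0LessThan)
    also have "\<dots> = es ! i * (U\<^sup>T *\<^sub>v x) $ i"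
      using i by (simp add: if_distribR if_distrib[of "\<lambda>t. t * _"] sum.delta' cong: if_cong)
    finally show "col U i \<bullet> (M *\<^sub>v x) = es ! i * (col U i \<bullet> x)" using coef[OF i] by simp
  qed
  then show ?thesis by blast
qed

section \<open>Power iterates and their Rayleigh quotients in coordinates\<close>

context orthonormal_eigenbasis
begin

lemma norm_sq: "x \<in> carrier_vec d \<Longrightarrow> x \<bullet> x = (\<Sum>i<d. (u i \<bullet> x)\<^sup>2)"
  by (simp add: parseval power2_eq_square)

text \<open>One nonzero coordinate of \<open>x\<close> suffices: positive \<open>\<mu>\<close> keeps
  it nonzero under every multiplication, so no iterate vanishes and no normalization divides by 0.
  The accumulated factor \<open>s\<close> stays unspecified; the unit norm eliminates it
  later.\<close>

lemma power_iterate_coefficients: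
  assumes x: "x \<in> carrier_vec d" and pos: "\<And>i. i < d \<Longrightarrow> 0 < \<mu> i" and j: "j < d" "u j \<bullet> x \<noteq> 0"
  shows "power_iterate M q x \<in> carrier_vec d \<and> (power_iterate M q x \<bullet> power_iterate M q x = 1) \<and>
    (\<exists>s>0. \<forall>i<d. u i \<bullet> power_iterate M q x = s * \<mu> i ^ q * (u i \<bullet> x))"
proof -
  have normalize: "vnormalize y \<in> carrier_vec d \<and> vnormalize y \<bullet> vnormalize y = 1 \<and>
    (\<exists>s>0. \<forall>i<d. u i \<bullet> vnormalize y = s * (u i \<bullet> y))"
    if y: "y \<in> carrier_vec d" and y0: "u j \<bullet> y \<noteq> 0" for y
  proof -
    have "0 < (u j \<bullet> y)\<^sup>2" using y0 by simp
    also have "\<dots> \<le> y \<bullet> y" unfolding norm_sq[OF y]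
      by (rule member_le_sum) (use j in auto)
    finally have "0 < y \<bullet> y" .
    then show ?thesis using y u
      by (auto simp: vnormalize_def vnorm_def smult_scalar_prod_distrib[of _ d]
          scalar_prod_smult_distrib[of _ d] intro!: exI[of _ "1 / sqrt (y \<bullet> y)"])
  qed
  show ?thesis
  proof (induction q)
    case 0
    then show ?case using normalize[OF x j(2)] by simp
  next
    case (Suc q)
    define y where "y = power_iterate M q x"
    from Suc obtain s where y: "y \<in> carrier_vec d" and s: "s > 0"
      and sy: "\<And>i. i < d \<Longrightarrow> u i \<bullet> y = s * \<mu> i ^ q * (u i \<bullet> x)" unfolding y_def by auto
    have My: "M *\<^sub>v y \<in> carrier_vec d" using M y by simp
    have c: "u i \<bullet> (M *\<^sub>v y) = s * \<mu> i ^ Suc q * (u i \<bullet> x)" if "i < d" for i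
      using u_mult[OF that y] sy[OF that] by simp
    have "u j \<bullet> (M *\<^sub>v y) \<noteq> 0" using c[OF j(1)] s j pos[OF j(1)] by simp
    from normalize[OF My this] obtain s' where
      N: "vnormalize (M *\<^sub>v y) \<in> carrier_vec d" "vnormalize (M *\<^sub>v y) \<bullet> vnormalize (M *\<^sub>v y) = 1"
      and s': "s' > 0" "\<And>i. i < d \<Longrightarrow> u i \<bullet> vnormalize (M *\<^sub>v y) = s' * (u i \<bullet> (M *\<^sub>v y))" by auto
    have "\<forall>i<d. u i \<bullet> vnormalize (M *\<^sub>v y) = (s' * s) * \<mu> i ^ Suc q * (u i \<bullet> x)"
      using s'(2) c by simp
    with N s s'(1) show ?case unfolding power_iterate.simps y_def[symmetric]
      by (intro conjI exI[of _ "s' * s"]) auto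
  qed
qed

text \<open>The gap is a weighted sum of the squared coordinates other than the top one. There
  \<open>\<mu> 0 - \<mu> i\<close> is bounded by \<open>\<mu> 0\<close>, and
  \<open>\<mu> i ^ (2 * q)\<close> by \<open>b ^ (2 * q)\<close>. The last quotient in the bound is
  the squared tangent of the angle between \<open>x\<close> and the line of
  \<open>u 0\<close>.\<close>

lemma rayleigh_gap:
  assumes x: "x \<in> carrier_vec d" and pos: "\<And>i. i < d \<Longrightarrow> 0 < \<mu> i"
    and x0: "u 0 \<bullet> x \<noteq> 0" and d: "0 < d"
    and b: "\<And>i. 0 < i \<Longrightarrow> i < d \<Longrightarrow> \<mu> i \<le> b"
  shows "\<mu> 0 - power_iterate M q x \<bullet> (M *\<^sub>v power_iterate M q x)
    \<le> \<mu> 0 * (b / \<mu> 0) ^ (2 * q) * ((x \<bullet> x - (u 0 \<bullet> x)\<^sup>2) / (u 0 \<bullet> x)\<^sup>2)"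
proof -
  define y where "y = power_iterate M q x"
  obtain s where y: "y \<in> carrier_vec d" and yy: "y \<bullet> y = 1" and s: "s > 0"
    and sy: "\<And>i. i < d \<Longrightarrow> u i \<bullet> y = s * \<mu> i ^ q * (u i \<bullet> x)"
    using power_iterate_coefficients[OF x pos d x0, of q] unfolding y_def by auto
  define a where "a i = (u i \<bullet> x)\<^sup>2" for i
  have sy2: "(u i \<bullet> y)\<^sup>2 = s\<^sup>2 * \<mu> i ^ (2 * q) * a i" if "i < d" for i
    by (simp add: sy[OF that] a_def power_mult_distrib power_mult mult.commute[of 2] )
  have m0: "0 < \<mu> 0" using pos d by simp
  have a0: "0 < a 0" using x0 by (simp add: a_def)
  have split: "{..<d} = insert 0 {0<..<d}" using d by auto
  \<comment> \<open>A coordinate of a unit vector is at most 1 in absolute value; for the top one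
    this bounds the unknown factor \<open>s\<close>.\<close>
  have one: "s\<^sup>2 * \<mu> 0 ^ (2 * q) * a 0 \<le> 1"
  proof -
    have "(u 0 \<bullet> y)\<^sup>2 \<le> y \<bullet> y" unfolding norm_sq[OF y] by (rule member_le_sum) (use d in auto)
    then show ?thesis using sy2[OF d] yy by simp
  qed
  have rayleigh: "y \<bullet> (M *\<^sub>v y) = (\<Sum>i<d. \<mu> i * (u i \<bullet> y)\<^sup>2)"
    using y M by (simp add: parseval u_mult power2_eq_square mult.left_commute)
  have "\<mu> 0 - y \<bullet> (M *\<^sub>v y) = \<mu> 0 * (y \<bullet> y) - y \<bullet> (M *\<^sub>v y)" by (simp add: yy)
  also have "\<dots> = (\<Sum>i<d. (\<mu> 0 - \<mu> i) * (u i \<bullet> y)\<^sup>2)"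
    unfolding rayleigh by (simp add: norm_sq[OF y] sum_distrib_left left_diff_distrib sum_subtractf)
  also have "\<dots> = (\<Sum>i\<in>{0<..<d}. (\<mu> 0 - \<mu> i) * (u i \<bullet> y)\<^sup>2)"
    unfolding split by simp
  also have "\<dots> \<le> (\<Sum>i\<in>{0<..<d}. \<mu> 0 * (s\<^sup>2 * b ^ (2 * q) * a i))"
  proof (rule sum_mono)
    fix i assume i: "i \<in> {0<..<d}"
    have "(\<mu> 0 - \<mu> i) * (u i \<bullet> y)\<^sup>2 \<le> \<mu> 0 * (u i \<bullet> y)\<^sup>2"
      using pos[of i] i by (intro mult_right_mono) auto
    also have "\<dots> \<le> \<mu> 0 * (s\<^sup>2 * b ^ (2 * q) * a i)"
      using i sy2[of i] m0 pos[of i] b[of i]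
      by (auto intro!: mult_left_mono mult_right_mono power_mono simp: a_def)
    finally show "(\<mu> 0 - \<mu> i) * (u i \<bullet> y)\<^sup>2 \<le> \<mu> 0 * (s\<^sup>2 * b ^ (2 * q) * a i)" .
  qed
  also have "\<dots> = s\<^sup>2 * (\<mu> 0 * b ^ (2 * q) * (\<Sum>i\<in>{0<..<d}. a i))"
    unfolding sum_distrib_left by (intro sum.cong) (simp_all add: mult_ac)
  also have "\<dots> \<le> (1 / (\<mu> 0 ^ (2 * q) * a 0)) * (\<mu> 0 * b ^ (2 * q) * (\<Sum>i\<in>{0<..<d}. a i))"
    using one m0 a0 by (intro mult_right_mono mult_nonneg_nonneg sum_nonneg)
      (auto simp: a_def field_simps power_mult)
  also have "\<dots> = \<mu> 0 * (b / \<mu> 0) ^ (2 * q) * ((\<Sum>i\<in>{0<..<d}. a i) / a 0)"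
    by (simp add: power_divide)
  also have "(\<Sum>i\<in>{0<..<d}. a i) = x \<bullet> x - a 0"
    unfolding norm_sq[OF x] split by (simp add: a_def)
  finally show ?thesis unfolding y_def a_def .
qed

end

text \<open>Samuelson's inequality: with \<open>a i = l 1 - l i \<ge> 0\<close> it reads
  \<open>(\<Sum>i. (a i)\<^sup>2) \<le> (\<Sum>i. a i)\<^sup>2\<close>.\<close>

lemma spec_mean_plus_sd_le_max:
  assumes d: "2 \<le> d" and le: "\<And>i. i \<in> {1..d} \<Longrightarrow> l i \<le> l 1"
  shows "spec_mean d l + spec_sd d l / sqrt (real d - 1) \<le> l 1"
proof -
  define a where "a i = l 1 - l i" for i
  define m where "m = spec_mean d l"
  have a0: "0 \<le> a i" if "i \<in> {1..d}" for i using le[OF that] by (simp add: a_def)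
  have sl: "(\<Sum>i=1..d. l i) = d * m" using d by (simp add: m_def spec_mean_def)
  have sa: "(\<Sum>i=1..d. a i) = d * (l 1 - m)" using sl by (simp add: a_def sum_subtractf right_diff_distrib)
  have sa2: "(\<Sum>i=1..d. (a i)\<^sup>2) = d * (l 1)\<^sup>2 - 2 * l 1 * (d * m) + (\<Sum>i=1..d. (l i)\<^sup>2)"
    by (simp add: a_def power2_diff sum.distrib sum_subtractf sum_distrib_left[symmetric] sl[symmetric])
  have "(\<Sum>i=1..d. (a i)\<^sup>2) \<le> (\<Sum>i=1..d. a i * (\<Sum>j=1..d. a j))"
    unfolding power2_eq_square
    by (intro sum_mono mult_left_mono member_le_sum) (use a0 in auto)
  also have "\<dots> = (d * (l 1 - m))\<^sup>2"
    using sa by (simp add: sum_distrib_right[symmetric] power2_eq_square)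
  finally have *: "(\<Sum>i=1..d. (l i)\<^sup>2) \<le> (d * (l 1 - m))\<^sup>2 - d * (l 1)\<^sup>2 + 2 * l 1 * (d * m)"
    using sa2 by linarith
  have d0: "0 < real d" using d by simp
  have lm: "0 \<le> l 1 - m"
  proof -
    have "0 \<le> (\<Sum>i=1..d. a i)" by (rule sum_nonneg) (use a0 in auto)
    then show ?thesis using sa d0 by (simp add: zero_le_mult_iff)
  qed
  have "(\<Sum>i=1..d. (l i)\<^sup>2) / d - m\<^sup>2 \<le> ((d * (l 1 - m))\<^sup>2 - d * (l 1)\<^sup>2 + 2 * l 1 * (d * m)) / d - m\<^sup>2"
    using * d0 by (simp add: divide_right_mono)
  \<comment> \<open>With t for \<open>l 1 - m\<close>, the previous expression is d t^2 - (l 1)^2 +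
    2 (l 1) m - m^2, that is, d t^2 - t^2.\<close>
  also have "\<dots> = (real d - 1) * (l 1 - m)\<^sup>2"
    using d0 by (simp add: field_simps power2_eq_square)
  finally have "spec_sd d l \<le> sqrt ((real d - 1) * (l 1 - m)\<^sup>2)"
    unfolding spec_sd_def m_def[symmetric] by simp
  also have "\<dots> = sqrt (real d - 1) * (l 1 - m)" using lm by (simp add: real_sqrt_mult)
  finally have "spec_sd d l / sqrt (real d - 1) \<le> l 1 - m"
    using d by (simp add: divide_le_eq mult.commute)
  then show ?thesis by (simp add: m_def)
qed

section \<open>Rotations, dilations and Gaussian measure of cones\<close>

abbreviation lebesgue_fun :: "nat \<Rightarrow> (nat \<Rightarrow> real) measure" where
  "lebesgue_fun k \<equiv> \<Pi>\<^sub>M i\<in>{..<k}. lborel"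

interpretation lborel_product: product_sigma_finite "\<lambda>_ :: nat. lborel :: real measure"
  by standard

lemma sigma_finite_lebesgue_fun: "sigma_finite_measure (lebesgue_fun k)"
  by (rule lborel_product.sigma_finite) simp

lemma pair_sigma_finite_lebesgue_fun: "pair_sigma_finite lborel (lebesgue_fun k)"
  by (intro pair_sigma_finite.intro sigma_finite_lebesgue_fun sigma_finite_lborel)

text \<open>A rotation made of two one-dimensional affine substitutions, one in \<open>x\<close> for
  fixed \<open>y\<close> and, after exchanging the integrals, one in \<open>y\<close> for fixed
  \<open>x\<close>. Applied to the two sides of the claim they lead to the same mixed integral with
  the same factor \<open>\<bar>r / a\<bar>\<close>. The number \<open>r\<close> may be 0 because the
  induction on the dimension meets norms of truncated vectors.\<close>

lemma nn_integral_rotate_plane: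
  fixes f :: "real \<Rightarrow> real \<Rightarrow> ennreal"
  assumes [measurable]: "case_prod f \<in> borel_measurable (borel \<Otimes>\<^sub>M borel)" and r: "a\<^sup>2 + b\<^sup>2 = r\<^sup>2"
  shows "(\<integral>\<^sup>+ y. \<integral>\<^sup>+ x. f (a * x + b * y) (x\<^sup>2 + y\<^sup>2) \<partial>lborel \<partial>lborel) =
    (\<integral>\<^sup>+ y. \<integral>\<^sup>+ x. f (r * x) (x\<^sup>2 + y\<^sup>2) \<partial>lborel \<partial>lborel)"
proof -
  have swap: "(\<integral>\<^sup>+ y. \<integral>\<^sup>+ x. g x y \<partial>lborel \<partial>lborel) = (\<integral>\<^sup>+ x. \<integral>\<^sup>+ y. g x y \<partial>lborel \<partial>lborel)"
    if [measurable]: "case_prod g \<in> borel_measurable (borel \<Otimes>\<^sub>M borel)" for g :: "real \<Rightarrow> real \<Rightarrow> ennreal"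
    by (rule lborel_pair.Fubini') measurable
  consider "r = 0" | "r \<noteq> 0" "a = 0" | "r \<noteq> 0" "a \<noteq> 0" by blast
  then show ?thesis
  proof cases
    case 1
    with r have "a = 0" "b = 0" by (auto simp: sum_power2_eq_zero_iff)
    with 1 show ?thesis by simp
  next
    case 2
    \<comment> \<open>\<open>e\<close> is 1 or -1: this case is a reflection followed by an exchange
      of the two coordinates.\<close>
    define e where "e = b / r"
    have "b\<^sup>2 = r\<^sup>2" using r 2 by simp
    then have e2: "e\<^sup>2 = 1" using 2 by (simp add: e_def power_divide)
    then have e: "\<bar>e\<bar> = 1" "e \<noteq> 0" by (auto simp: power2_eq_1_iff)
    have be: "b * e = r" using \<open>b\<^sup>2 = r\<^sup>2\<close> 2 by (simp add: e_def power2_eq_square)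
    have "(\<integral>\<^sup>+ y. \<integral>\<^sup>+ x. f (a * x + b * y) (x\<^sup>2 + y\<^sup>2) \<partial>lborel \<partial>lborel) =
      (\<integral>\<^sup>+ y. \<integral>\<^sup>+ x. f (b * (e * y)) (x\<^sup>2 + (e * y)\<^sup>2) \<partial>lborel \<partial>lborel)"
      by (subst nn_integral_real_affine[where c = e and t = 0], measurable) (use 2 e in simp_all)
    also have "\<dots> = (\<integral>\<^sup>+ y. \<integral>\<^sup>+ x. f (r * y) (x\<^sup>2 + y\<^sup>2) \<partial>lborel \<partial>lborel)"
      by (simp add: be[symmetric] power_mult_distrib e2 mult.assoc)
    also have "\<dots> = (\<integral>\<^sup>+ x. \<integral>\<^sup>+ y. f (r * y) (x\<^sup>2 + y\<^sup>2) \<partial>lborel \<partial>lborel)"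
      by (rule swap) measurable
    finally show ?thesis by (simp add: add.commute)
  next
    case 3
    have inner: "(\<integral>\<^sup>+ x. f (a * x + b * y) (x\<^sup>2 + y\<^sup>2) \<partial>lborel) =
      \<bar>r / a\<bar> * (\<integral>\<^sup>+ x. f (r * x) (((r * x - b * y) / a)\<^sup>2 + y\<^sup>2) \<partial>lborel)" for y
    proof -
      have "a * (- (b * y / a) + r / a * x) + b * y = r * x"
        "- (b * y / a) + r / a * x = (r * x - b * y) / a" for x
        using 3 by (simp_all add: field_simps)
      then show ?thesis
        using 3 by (subst nn_integral_real_affine[where c = "r / a" and t = "- (b * y / a)"]) simp_all
    qed
    \<comment> \<open>With \<open>x\<close> the new first coordinate and \<open>y\<close> the old
      second one, the left side is the squared norm before the rotation and the right side the
      squared norm after it.\<close>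
    have sq: "((r * x - b * y) / a)\<^sup>2 + y\<^sup>2 = x\<^sup>2 + ((r * y - b * x) / a)\<^sup>2" for x y
    proof -
      have "(r * x - b * y)\<^sup>2 + a\<^sup>2 * y\<^sup>2 = a\<^sup>2 * x\<^sup>2 + (r * y - b * x)\<^sup>2"
        unfolding power2_diff power_mult_distrib r[symmetric] by (simp add: algebra_simps)
      then show ?thesis using 3 by (simp add: field_simps)
    qed
    have outer: "(\<integral>\<^sup>+ y. f (r * x) (x\<^sup>2 + y\<^sup>2) \<partial>lborel) =
       \<bar>r / a\<bar> * (\<integral>\<^sup>+ y. f (r * x) (x\<^sup>2 + ((r * y - b * x) / a)\<^sup>2) \<partial>lborel)" for x
    proof -
      have "- (b * x / a) + r / a * y = (r * y - b * x) / a" for y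
        using 3 by (simp_all add: field_simps)
      then show ?thesis
        using 3 by (subst nn_integral_real_affine[where c = "r / a" and t = "- (b * x / a)"]) simp_all
    qed
    have "(\<integral>\<^sup>+ y. \<integral>\<^sup>+ x. f (a * x + b * y) (x\<^sup>2 + y\<^sup>2) \<partial>lborel \<partial>lborel) =
      (\<integral>\<^sup>+ y. \<bar>r / a\<bar> * (\<integral>\<^sup>+ x. f (r * x) (x\<^sup>2 + ((r * y - b * x) / a)\<^sup>2) \<partial>lborel) \<partial>lborel)"
      unfolding inner sq ..
    also have "\<dots> = \<bar>r / a\<bar> * (\<integral>\<^sup>+ y. \<integral>\<^sup>+ x. f (r * x) (x\<^sup>2 + ((r * y - b * x) / a)\<^sup>2) \<partial>lborel \<partial>lborel)"
      by (rule nn_integral_cmult) measurable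
    also have "\<dots> = \<bar>r / a\<bar> * (\<integral>\<^sup>+ x. \<integral>\<^sup>+ y. f (r * x) (x\<^sup>2 + ((r * y - b * x) / a)\<^sup>2) \<partial>lborel \<partial>lborel)"
      by (subst swap) auto
    also have "\<dots> = (\<integral>\<^sup>+ x. \<bar>r / a\<bar> * (\<integral>\<^sup>+ y. f (r * x) (x\<^sup>2 + ((r * y - b * x) / a)\<^sup>2) \<partial>lborel) \<partial>lborel)"
      by (rule nn_integral_cmult[symmetric]) measurable
    also have "\<dots> = (\<integral>\<^sup>+ x. \<integral>\<^sup>+ y. f (r * x) (x\<^sup>2 + y\<^sup>2) \<partial>lborel \<partial>lborel)"
      unfolding outer ..
    also have "\<dots> = (\<integral>\<^sup>+ y. \<integral>\<^sup>+ x. f (r * x) (x\<^sup>2 + y\<^sup>2) \<partial>lborel \<partial>lborel)"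
      by (rule swap[symmetric]) measurable
    finally show ?thesis .
  qed
qed

lemma measurable_sum_lebesgue_fun [measurable]:
  assumes "\<And>i. i < k \<Longrightarrow> g i \<in> borel_measurable borel"
  shows "(\<lambda>x. \<Sum>i<k. g i (x i) :: real) \<in> borel_measurable (lebesgue_fun k)"
proof (rule borel_measurable_sum)
  fix i assume "i \<in> {..<k}"
  then have "(\<lambda>x. x i) \<in> measurable (lebesgue_fun k) borel" "g i \<in> borel_measurable borel"
    using assms measurable_component_singleton[of i "{..<k}" "\<lambda>_. lborel :: real measure"] by auto
  then show "(\<lambda>x. g i (x i)) \<in> borel_measurable (lebesgue_fun k)" by measurable
qed

lemma measurable_linear_norm_sq:
  fixes f :: "real \<Rightarrow> real \<Rightarrow> 'a :: topological_space"
  assumes [measurable]: "case_prod f \<in> borel_measurable (borel \<Otimes>\<^sub>M borel)"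
  shows "(\<lambda>x. f (\<Sum>i<k. v i * x i) (\<Sum>i<k. (x i)\<^sup>2)) \<in> borel_measurable (lebesgue_fun k)"
proof -
  define p where "p x = (\<Sum>i<k. v i * x i)" for x :: "nat \<Rightarrow> real"
  define q where "q x = (\<Sum>i<k. (x i)\<^sup>2)" for x :: "nat \<Rightarrow> real"
  have [measurable]: "p \<in> borel_measurable (lebesgue_fun k)" "q \<in> borel_measurable (lebesgue_fun k)"
    unfolding p_def q_def by measurable
  have "(\<lambda>x. f (p x) (q x)) \<in> borel_measurable (lebesgue_fun k)" by measurable
  then show ?thesis unfolding p_def q_def .
qed

lemma nn_integral_lebesgue_fun_Suc:
  assumes "f \<in> borel_measurable (lebesgue_fun (Suc k))"
  shows "(\<integral>\<^sup>+ x. f x \<partial>lebesgue_fun (Suc k)) = (\<integral>\<^sup>+ y. \<integral>\<^sup>+ x. f (x(k := y)) \<partial>lebesgue_fun k \<partial>lborel)"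
    "(\<integral>\<^sup>+ x. f x \<partial>lebesgue_fun (Suc k)) = (\<integral>\<^sup>+ x. \<integral>\<^sup>+ y. f (x(k := y)) \<partial>lborel \<partial>lebesgue_fun k)"
  using lborel_product.product_nn_integral_insert_rev[of "{..<k}" k f]
    lborel_product.product_nn_integral_insert[of "{..<k}" k f] assms
  by (simp_all add: lessThan_Suc)

lemma sum_update: "(\<Sum>i<k. g i ((x(k := y)) i)) = (\<Sum>i<k. g i (x i))" for k :: nat
  by (intro sum.cong) auto

text \<open>In the induction step the first \<open>Suc k\<close> coordinates become one component
  \<open>t\<close> along the truncated \<open>v\<close> and \<open>k\<close> others; a rotation in
  the plane of \<open>t\<close> and the last coordinate then merges these two. \<open>f\<close> and
  \<open>r\<close> have to be arbitrary: the last coordinate shifts both arguments of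
  \<open>f\<close>, and the truncated vector has a norm of its own.\<close>

lemma nn_integral_rotate:
  fixes f :: "real \<Rightarrow> real \<Rightarrow> ennreal"
  assumes "case_prod f \<in> borel_measurable (borel \<Otimes>\<^sub>M borel)" and "(\<Sum>i<Suc k. (v i)\<^sup>2) = r\<^sup>2"
  shows "(\<integral>\<^sup>+ x. f (\<Sum>i<Suc k. v i * x i) (\<Sum>i<Suc k. (x i)\<^sup>2) \<partial>lebesgue_fun (Suc k)) =
    (\<integral>\<^sup>+ h. \<integral>\<^sup>+ t. f (r * t) (t\<^sup>2 + (\<Sum>i<k. (h i)\<^sup>2)) \<partial>lborel \<partial>lebesgue_fun k)"
  using assms
proof (induction k arbitrary: f r)
  case 0
  note [measurable] = 0(1)
  have "(\<integral>\<^sup>+ x. f (\<Sum>i<Suc 0. v i * x i) (\<Sum>i<Suc 0. (x i)\<^sup>2) \<partial>lebesgue_fun (Suc 0)) =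
    (\<integral>\<^sup>+ x. f (v 0 * x 0) ((x 0)\<^sup>2) \<partial>(\<Pi>\<^sub>M i\<in>{0 :: nat}. lborel))"
    by (simp add: lessThan_Suc)
  also have "\<dots> = (\<integral>\<^sup>+ t. f (v 0 * t) (t\<^sup>2) \<partial>lborel)"
    by (subst lborel_product.product_nn_integral_singleton[of "\<lambda>t. f (v 0 * t) (t\<^sup>2)" 0]) auto
  also have "\<dots> = (\<integral>\<^sup>+ t. f (r * t) (t\<^sup>2) \<partial>lborel)"
  proof -
    have "v 0 = r \<or> v 0 = - r" using 0(2) by (simp add: power2_eq_iff)
    then show ?thesis
      by (elim disjE) (simp, subst nn_integral_real_affine[where c = "-1" and t = 0], auto)
  qed
  finally show ?case by (simp add: nn_integral_count_space_finite PiM_empty)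
next
  case (Suc k)
  note [measurable] = Suc.prems(1)
  define b where "b = v (Suc k)"
  define s where "s = sqrt (\<Sum>i<Suc k. (v i)\<^sup>2)"
  have s: "(\<Sum>i<Suc k. (v i)\<^sup>2) = s\<^sup>2" by (simp add: s_def sum_nonneg)
  have sb: "s\<^sup>2 + b\<^sup>2 = r\<^sup>2" using Suc.prems(2) unfolding s[symmetric] b_def by simp
  define q where "q h = (\<Sum>i<k. (h i)\<^sup>2)" for h :: "nat \<Rightarrow> real"
  define q' where "q' h = (\<Sum>i<Suc k. (h i)\<^sup>2)" for h :: "nat \<Rightarrow> real"
  have [measurable]: "q' \<in> borel_measurable (lebesgue_fun (Suc k))"
    unfolding q'_def by (rule measurable_sum_lebesgue_fun) measurable
  have q': "q' (h(k := y)) = q h + y\<^sup>2" for h y by (simp add: q_def q'_def sum_update)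
  have [measurable]: "q \<in> borel_measurable (lebesgue_fun k)" unfolding q_def by measurable
  have "(\<integral>\<^sup>+ x. f (\<Sum>i<Suc (Suc k). v i * x i) (\<Sum>i<Suc (Suc k). (x i)\<^sup>2) \<partial>lebesgue_fun (Suc (Suc k))) =
    (\<integral>\<^sup>+ y. \<integral>\<^sup>+ x. f ((\<Sum>i<Suc k. v i * x i) + b * y) ((\<Sum>i<Suc k. (x i)\<^sup>2) + y\<^sup>2) \<partial>lebesgue_fun (Suc k) \<partial>lborel)"
    by (subst nn_integral_lebesgue_fun_Suc(1), rule measurable_linear_norm_sq, rule Suc.prems)
      (simp add: sum.lessThan_Suc[of _ "Suc k"] sum_update b_def del: sum.lessThan_Suc)
  also have "\<dots> = (\<integral>\<^sup>+ y. \<integral>\<^sup>+ h. \<integral>\<^sup>+ t. f (s * t + b * y) (t\<^sup>2 + q h + y\<^sup>2) \<partial>lborel \<partial>lebesgue_fun k \<partial>lborel)"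
    unfolding q_def
    by (intro nn_integral_cong Suc.IH[OF _ s, of "\<lambda>t w. f (t + b * y) (w + y\<^sup>2)" for y]) measurable
  also have "\<dots> = (\<integral>\<^sup>+ h. \<integral>\<^sup>+ y. \<integral>\<^sup>+ t. f (s * t + b * y) (t\<^sup>2 + q h + y\<^sup>2) \<partial>lborel \<partial>lborel \<partial>lebesgue_fun k)"
    by (rule pair_sigma_finite.Fubini'[OF pair_sigma_finite_lebesgue_fun, symmetric]) measurable
  also have "\<dots> = (\<integral>\<^sup>+ h. \<integral>\<^sup>+ y. \<integral>\<^sup>+ t. f (s * t + b * y) ((t\<^sup>2 + y\<^sup>2) + q h) \<partial>lborel \<partial>lborel \<partial>lebesgue_fun k)"
    by (simp add: add_ac)
  also have "\<dots> = (\<integral>\<^sup>+ h. \<integral>\<^sup>+ y. \<integral>\<^sup>+ t. f (r * t) ((t\<^sup>2 + y\<^sup>2) + q h) \<partial>lborel \<partial>lborel \<partial>lebesgue_fun k)"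
    by (intro nn_integral_cong nn_integral_rotate_plane[OF _ sb, of "\<lambda>t w. f t (w + q h)" for h]) measurable
  \<comment> \<open>The coordinate \<open>y\<close> left over by the plane rotation becomes the last
    entry of \<open>h\<close>.\<close>
  also have "\<dots> = (\<integral>\<^sup>+ h. \<integral>\<^sup>+ t. f (r * t) (t\<^sup>2 + q' h) \<partial>lborel \<partial>lebesgue_fun (Suc k))"
    by (subst nn_integral_lebesgue_fun_Suc(2), measurable) (simp add: q' add_ac)
  finally show ?case unfolding q'_def .
qed

text \<open>Each coordinate contributes one factor \<open>c\<close>. The terms of the coordinate
  split off are absorbed into \<open>f\<close>, which is therefore arbitrary in the
  induction.\<close>

lemma nn_integral_scale:
  fixes f :: "real \<Rightarrow> real \<Rightarrow> ennreal"
  assumes "case_prod f \<in> borel_measurable (borel \<Otimes>\<^sub>M borel)" and c: "0 < c"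
  shows "(\<integral>\<^sup>+ x. f (\<Sum>i<k. v i * x i) (\<Sum>i<k. (x i)\<^sup>2) \<partial>lebesgue_fun k) =
    ennreal (c ^ k) * (\<integral>\<^sup>+ x. f (c * (\<Sum>i<k. v i * x i)) (c\<^sup>2 * (\<Sum>i<k. (x i)\<^sup>2)) \<partial>lebesgue_fun k)"
  using assms(1)
proof (induction k arbitrary: f)
  case 0
  then show ?case by simp
next
  case (Suc k)
  note [measurable] = Suc.prems
  define p where "p x = (\<Sum>i<k. v i * x i)" for x :: "nat \<Rightarrow> real"
  define q where "q x = (\<Sum>i<k. (x i)\<^sup>2)" for x :: "nat \<Rightarrow> real"
  have [measurable]: "p \<in> borel_measurable (lebesgue_fun k)" "q \<in> borel_measurable (lebesgue_fun k)"
    unfolding p_def q_def by measurable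
  have up: "p (x(k := y)) = p x" "q (x(k := y)) = q x" for x y
    by (simp_all add: p_def q_def sum_update)
  interpret sigma_finite_measure "lebesgue_fun k" by (rule sigma_finite_lebesgue_fun)
  have "(\<integral>\<^sup>+ x. f (\<Sum>i<Suc k. v i * x i) (\<Sum>i<Suc k. (x i)\<^sup>2) \<partial>lebesgue_fun (Suc k)) =
    (\<integral>\<^sup>+ y. \<integral>\<^sup>+ x. f (p x + v k * y) (q x + y\<^sup>2) \<partial>lebesgue_fun k \<partial>lborel)"
    by (subst nn_integral_lebesgue_fun_Suc(1), rule measurable_linear_norm_sq, rule Suc.prems)
      (simp add: p_def q_def sum_update)
  also have "\<dots> = (\<integral>\<^sup>+ y. ennreal (c ^ k) * (\<integral>\<^sup>+ x. f (c * p x + v k * y) (c\<^sup>2 * q x + y\<^sup>2) \<partial>lebesgue_fun k) \<partial>lborel)"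
    unfolding p_def q_def
    by (intro nn_integral_cong Suc.IH[of "\<lambda>t w. f (t + v k * y) (w + y\<^sup>2)" for y]) measurable
  also have "\<dots> = ennreal (c ^ k) * (\<integral>\<^sup>+ y. (\<integral>\<^sup>+ x. f (c * p x + v k * y) (c\<^sup>2 * q x + y\<^sup>2) \<partial>lebesgue_fun k) \<partial>lborel)"
    by (rule nn_integral_cmult) measurable
  also have "(\<integral>\<^sup>+ y. (\<integral>\<^sup>+ x. f (c * p x + v k * y) (c\<^sup>2 * q x + y\<^sup>2) \<partial>lebesgue_fun k) \<partial>lborel) =
    ennreal c * (\<integral>\<^sup>+ y. (\<integral>\<^sup>+ x. f (c * p x + v k * (c * y)) (c\<^sup>2 * q x + (c * y)\<^sup>2) \<partial>lebesgue_fun k) \<partial>lborel)"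
    using c by (subst nn_integral_real_affine[where c = c and t = 0]) auto
  also have "(\<integral>\<^sup>+ y. (\<integral>\<^sup>+ x. f (c * p x + v k * (c * y)) (c\<^sup>2 * q x + (c * y)\<^sup>2) \<partial>lebesgue_fun k) \<partial>lborel) =
    (\<integral>\<^sup>+ x. f (c * (\<Sum>i<Suc k. v i * x i)) (c\<^sup>2 * (\<Sum>i<Suc k. (x i)\<^sup>2)) \<partial>lebesgue_fun (Suc k))"
    by (subst nn_integral_lebesgue_fun_Suc(1),
        rule measurable_linear_norm_sq[of "\<lambda>t w. f (c * t) (c\<^sup>2 * w)"], measurable)
      (simp add: p_def q_def sum_update power_mult_distrib algebra_simps)
  finally show ?case using c by (simp add: mult.assoc[symmetric] ennreal_mult' mult.commute)
qed

section \<open>Gaussian moments and the Gaussian measure of the complement of a cone\<close>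

lemma prod_std_normal_density:
  "(\<Prod>i<k. std_normal_density (x i)) = (1 / sqrt (2 * pi)) ^ k * exp (- (\<Sum>i<k. (x i)\<^sup>2) / 2)"
  by (simp add: std_normal_density_def prod.distrib exp_sum[symmetric] sum_negf sum_divide_distrib
      power_one_over power_divide prod_dividef)

lemma nn_integral_std_normal_density: "(\<integral>\<^sup>+ x. ennreal (std_normal_density x) \<partial>lborel) = 1"
  using prob_space.emeasure_space_1[OF prob_space_normal_density[of 1 0]]
  by (simp add: emeasure_density)

lemma nn_integral_std_normal_density_sq:
  "(\<integral>\<^sup>+ x. ennreal (std_normal_density x * x\<^sup>2) \<partial>lborel) = 1"
proof -
  have "has_bochner_integral lborel (\<lambda>x. std_normal_density x * x ^ (2 * 1))
      (fact (2 * 1) / (2 ^ 1 * fact 1))"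
    by (rule std_normal_moment_even)
  then show ?thesis by (subst nn_integral_eq_integral) (auto simp: has_bochner_integral_iff)
qed

lemma measurable_prod_std_normal_density [measurable]:
  "(\<lambda>x. \<Prod>i<k. std_normal_density (x i)) \<in> borel_measurable (lebesgue_fun k)"
  unfolding prod_std_normal_density
  by (rule measurable_linear_norm_sq[of "\<lambda>t w. (1 / sqrt (2 * pi)) ^ k * exp (- w / 2)"]) measurable

lemma nn_integral_gaussian_fun: "(\<integral>\<^sup>+ x. ennreal (\<Prod>i<k. std_normal_density (x i)) \<partial>lebesgue_fun k) = 1"
  using lborel_product.product_nn_integral_prod[of "{..<k}" "\<lambda>_ x. ennreal (std_normal_density x)"]
  by (simp add: prod_ennreal nn_integral_std_normal_density)

lemma nn_integral_gaussian_fun_sq: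
  "(\<integral>\<^sup>+ x. ennreal ((\<Prod>i<k. std_normal_density (x i)) * (\<Sum>i<k. (x i)\<^sup>2)) \<partial>lebesgue_fun k) = of_nat k"
proof -
  have one: "(\<integral>\<^sup>+ x. ennreal ((\<Prod>i<k. std_normal_density (x i)) * (x j)\<^sup>2) \<partial>lebesgue_fun k) = 1"
    if j: "j < k" for j
  proof -
    \<comment> \<open>Squaring one coordinate alters one factor only, so the integral still splits
      into a product. Every factor is 1, either as total mass or as second moment.\<close>
    define g where "g i x = (if i = j then std_normal_density x * x\<^sup>2 else std_normal_density x)" for i x
    have g: "0 \<le> g i x" for i x by (simp add: g_def)
    have "(\<Prod>i<k. std_normal_density (x i)) * (x j)\<^sup>2 = (\<Prod>i<k. g i (x i))" for x :: "nat \<Rightarrow> real"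
      using j by (simp add: g_def prod.remove[of "{..<k}" j])
    then have "(\<integral>\<^sup>+ x. ennreal ((\<Prod>i<k. std_normal_density (x i)) * (x j)\<^sup>2) \<partial>lebesgue_fun k) =
      (\<integral>\<^sup>+ x. (\<Prod>i<k. ennreal (g i (x i))) \<partial>lebesgue_fun k)"
      using g by (simp add: prod_ennreal)
    also have "\<dots> = (\<Prod>i<k. \<integral>\<^sup>+ x. ennreal (g i x) \<partial>lborel)"
      by (rule lborel_product.product_nn_integral_prod) (auto simp: g_def)
    also have "\<dots> = 1"
    proof (intro prod.neutral ballI)
      fix i
      show "(\<integral>\<^sup>+ x. ennreal (g i x) \<partial>lborel) = 1"
        by (cases "i = j")
          (simp_all add: g_def nn_integral_std_normal_density nn_integral_std_normal_density_sq)
    qed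
    finally show ?thesis .
  qed
  have "(\<integral>\<^sup>+ x. ennreal ((\<Prod>i<k. std_normal_density (x i)) * (\<Sum>i<k. (x i)\<^sup>2)) \<partial>lebesgue_fun k) =
    (\<integral>\<^sup>+ x. (\<Sum>j<k. ennreal ((\<Prod>i<k. std_normal_density (x i)) * (x j)\<^sup>2)) \<partial>lebesgue_fun k)"
    by (simp add: sum_distrib_left prod_nonneg sum_ennreal)
  also have "\<dots> = (\<Sum>j<k. \<integral>\<^sup>+ x. ennreal ((\<Prod>i<k. std_normal_density (x i)) * (x j)\<^sup>2) \<partial>lebesgue_fun k)"
  proof (rule nn_integral_sum)
    fix j assume "j \<in> {..<k}"
    then have [measurable]: "(\<lambda>x. x j) \<in> borel_measurable (lebesgue_fun k)"
      using measurable_component_singleton[of j "{..<k}" "\<lambda>_. lborel :: real measure"] by auto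
    show "(\<lambda>x. ennreal ((\<Prod>i<k. std_normal_density (x i)) * (x j)\<^sup>2)) \<in> borel_measurable (lebesgue_fun k)"
      by measurable
  qed
  also have "\<dots> = of_nat k" using one by simp
  finally show ?thesis .
qed

text \<open>Jensen's inequality by hand: the square root lies below its tangent at \<open>k\<close>,
  which is \<open>1 / (2 * s) * w + s / 2\<close> for \<open>s = sqrt k\<close>. The squared norm
  has expectation \<open>k\<close>, so both terms contribute \<open>s / 2\<close>.\<close>

lemma nn_integral_gaussian_norm_le:
  "(\<integral>\<^sup>+ x. ennreal ((\<Prod>i<k. std_normal_density (x i)) * sqrt (\<Sum>i<k. (x i)\<^sup>2)) \<partial>lebesgue_fun k) \<le> ennreal (sqrt k)"
proof (cases "k = 0")
  case True
  then show ?thesis by simp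
next
  case False
  define s where "s = sqrt k"
  have s: "s > 0" "s\<^sup>2 = k" using False by (simp_all add: s_def)
  let ?G = "\<lambda>x :: nat \<Rightarrow> real. \<Prod>i<k. std_normal_density (x i)" and ?q = "\<lambda>x :: nat \<Rightarrow> real. \<Sum>i<k. (x i)\<^sup>2"
  have G: "0 \<le> ?G x" for x by (rule prod_nonneg) simp
  have q: "0 \<le> ?q x" for x by (rule sum_nonneg) simp
  have amgm: "sqrt w \<le> 1 / (2 * s) * w + s / 2" if "0 \<le> w" for w
  proof -
    have "0 \<le> (sqrt w - s)\<^sup>2" by simp
    then have "2 * s * sqrt w \<le> w + s\<^sup>2" using that by (simp add: power2_diff mult_ac)
    then show ?thesis using s by (simp add: field_simps power2_eq_square)
  qed
  have [measurable]: "(\<lambda>x. ?G x * ?q x) \<in> borel_measurable (lebesgue_fun k)"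
    by (intro borel_measurable_times measurable_prod_std_normal_density measurable_sum_lebesgue_fun) auto
  have "(\<integral>\<^sup>+ x. ennreal (?G x * sqrt (?q x)) \<partial>lebesgue_fun k) \<le>
    (\<integral>\<^sup>+ x. ennreal (1 / (2 * s)) * ennreal (?G x * ?q x) + ennreal (s / 2) * ennreal (?G x) \<partial>lebesgue_fun k)"
  proof (rule nn_integral_mono)
    fix x
    have "?G x * sqrt (?q x) \<le> ?G x * (1 / (2 * s) * ?q x + s / 2)"
      by (rule mult_left_mono[OF amgm[OF q] G])
    also have "\<dots> = 1 / (2 * s) * (?G x * ?q x) + s / 2 * ?G x" by (simp add: algebra_simps)
    finally have "ennreal (?G x * sqrt (?q x)) \<le> ennreal (1 / (2 * s) * (?G x * ?q x) + s / 2 * ?G x)"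
      by (rule ennreal_leI)
    also have "\<dots> = ennreal (1 / (2 * s)) * ennreal (?G x * ?q x) + ennreal (s / 2) * ennreal (?G x)"
      using s G[of x] q[of x] by (subst ennreal_plus) (auto simp: ennreal_mult'[symmetric])
    finally show "ennreal (?G x * sqrt (?q x)) \<le>
      ennreal (1 / (2 * s)) * ennreal (?G x * ?q x) + ennreal (s / 2) * ennreal (?G x)" .
  qed
  also have "\<dots> = ennreal (1 / (2 * s)) * of_nat k + ennreal (s / 2)"
    by (simp add: nn_integral_add nn_integral_cmult nn_integral_gaussian_fun nn_integral_gaussian_fun_sq)
  also have "\<dots> = ennreal (1 / (2 * s) * k + s / 2)"
    using s by (simp add: ennreal_of_nat_eq_real_of_nat ennreal_mult'[symmetric])
  also have "1 / (2 * s) * k + s / 2 = s" using s by (simp add: s(2)[symmetric] field_simps power2_eq_square)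
  finally show ?thesis by (simp add: s_def)
qed

text \<open>After rotating \<open>v\<close> to the first axis the event says that the first coordinate lies in an
  interval of length \<open>2 / sqrt \<kappa>\<close> times the norm of the other \<open>k\<close> coordinates. The Gaussian density
  is at most \<open>1 / sqrt (2 * pi)\<close>, and that norm has expectation at most \<open>sqrt k\<close>.\<close>

lemma gaussian_cone_complement_le:
  fixes k :: nat and v :: "nat \<Rightarrow> real"
  assumes v: "(\<Sum>i<Suc k. (v i)\<^sup>2) = 1" and \<kappa>: "0 < \<kappa>"
  defines "p \<equiv> \<lambda>x. \<Sum>i<Suc k. v i * x i" and "q \<equiv> \<lambda>x :: nat \<Rightarrow> real. \<Sum>i<Suc k. (x i)\<^sup>2"
  shows "(\<integral>\<^sup>+ x. (if p x \<noteq> 0 \<and> q x - (p x)\<^sup>2 \<le> \<kappa> * (p x)\<^sup>2 then 0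
      else ennreal (\<Prod>i<Suc k. std_normal_density (x i))) \<partial>lebesgue_fun (Suc k))
    \<le> ennreal (sqrt (2 / pi) * sqrt k / sqrt \<kappa>)"
proof -
  let ?C = "1 / sqrt (2 * pi)"
  define f where "f t w = (if t \<noteq> 0 \<and> w - t\<^sup>2 \<le> \<kappa> * t\<^sup>2 then 0 else ennreal (?C ^ Suc k * exp (- w / 2)))" for t w
  have [measurable]: "case_prod f \<in> borel_measurable (borel \<Otimes>\<^sub>M borel)"
    unfolding f_def by measurable
  define Q where "Q x = (\<Sum>i<k. (x i)\<^sup>2)" for x :: "nat \<Rightarrow> real"
  define G where "G x = (\<Prod>i<k. std_normal_density (x i))" for x :: "nat \<Rightarrow> real"
  have Q: "0 \<le> Q x" for x unfolding Q_def by (rule sum_nonneg) simp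
  have G: "0 \<le> G x" for x unfolding G_def by (rule prod_nonneg) simp
  have [measurable]: "Q \<in> borel_measurable (lebesgue_fun k)" "G \<in> borel_measurable (lebesgue_fun k)"
    unfolding Q_def G_def by measurable
  have inner: "(\<integral>\<^sup>+ t. f (1 * t) (t\<^sup>2 + Q h) \<partial>lborel) \<le> ennreal (sqrt (2 / pi) / sqrt \<kappa>) * ennreal (G h * sqrt (Q h))" for h
  proof -
    let ?r = "sqrt (Q h) / sqrt \<kappa>"
    have "f (1 * t) (t\<^sup>2 + Q h) \<le> ennreal (?C * G h) * indicator {-?r..?r} t" for t
    proof (cases "t \<noteq> 0 \<and> Q h \<le> \<kappa> * t\<^sup>2")
      case True
      then show ?thesis by (simp add: f_def)
    next
      case False
      \<comment> \<open>The negation leaves \<open>t = 0\<close> or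
        \<open>Q h > \<kappa> * t\<^sup>2\<close>; in the first case the claim is
        \<open>0 \<le> Q h\<close>.\<close>
      then have "\<kappa> * t\<^sup>2 \<le> Q h" using Q[of h] by auto
      then have "sqrt (t\<^sup>2) \<le> sqrt (Q h / \<kappa>)"
        using \<kappa> by (intro real_sqrt_le_mono) (simp add: field_simps)
      then have t: "\<bar>t\<bar> \<le> ?r" by (simp add: real_sqrt_divide)
      \<comment> \<open>The density factor of \<open>t\<close> is split off and bounded by its
        maximum \<open>?C\<close>; the density of the other coordinates stays.\<close>
      have "?C ^ Suc k * exp (- (t\<^sup>2 + Q h) / 2) = ?C * exp (- t\<^sup>2 / 2) * G h"
        unfolding G_def prod_std_normal_density Q_def[symmetric]
        by (simp add: exp_add[symmetric] add_divide_distrib diff_divide_distrib)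
      also have "\<dots> \<le> ?C * 1 * G h"
        using G[of h] by (intro mult_right_mono mult_left_mono) auto
      finally have "f (1 * t) (t\<^sup>2 + Q h) \<le> ennreal (?C * G h)"
        using False by (auto simp: f_def intro!: ennreal_leI)
      then show ?thesis using t by (auto simp: indicator_def)
    qed
    then have "(\<integral>\<^sup>+ t. f (1 * t) (t\<^sup>2 + Q h) \<partial>lborel) \<le> (\<integral>\<^sup>+ t. ennreal (?C * G h) * indicator {-?r..?r} t \<partial>lborel)"
      by (rule nn_integral_mono)
    also have "\<dots> = ennreal (?C * G h) * ennreal (2 * ?r)"
      using Q[of h] \<kappa> by (simp add: nn_integral_cmult_indicator)
    also have "\<dots> = ennreal (?C * G h * (2 * ?r))"
      using Q[of h] G[of h] \<kappa> by (intro ennreal_mult'[symmetric]) auto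
    \<comment> \<open>Maximal density \<open>?C\<close> times interval length \<open>2 * ?r\<close>:
      the origin of the constant \<open>sqrt (2 / pi)\<close>.\<close>
    also have "?C * G h * (2 * ?r) = (2 * ?C) / sqrt \<kappa> * (G h * sqrt (Q h))" by simp
    also have "2 * ?C = sqrt (2 / pi)"
      by (simp add: real_sqrt_mult real_sqrt_divide field_simps)
    also have "ennreal (sqrt (2 / pi) / sqrt \<kappa> * (G h * sqrt (Q h))) =
      ennreal (sqrt (2 / pi) / sqrt \<kappa>) * ennreal (G h * sqrt (Q h))"
      using \<kappa> by (intro ennreal_mult') auto
    finally show ?thesis .
  qed
  have "(\<integral>\<^sup>+ x. (if p x \<noteq> 0 \<and> q x - (p x)\<^sup>2 \<le> \<kappa> * (p x)\<^sup>2 then 0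
      else ennreal (\<Prod>i<Suc k. std_normal_density (x i))) \<partial>lebesgue_fun (Suc k)) =
    (\<integral>\<^sup>+ x. f (p x) (q x) \<partial>lebesgue_fun (Suc k))"
    unfolding prod_std_normal_density f_def q_def ..
  also have "\<dots> = (\<integral>\<^sup>+ h. \<integral>\<^sup>+ t. f (1 * t) (t\<^sup>2 + Q h) \<partial>lborel \<partial>lebesgue_fun k)"
    unfolding p_def q_def Q_def by (rule nn_integral_rotate) (use v in \<open>simp_all del: sum.lessThan_Suc\<close>)
  also have "\<dots> \<le> (\<integral>\<^sup>+ h. ennreal (sqrt (2 / pi) / sqrt \<kappa>) * ennreal (G h * sqrt (Q h)) \<partial>lebesgue_fun k)"
    by (rule nn_integral_mono) (rule inner)
  also have "\<dots> = ennreal (sqrt (2 / pi) / sqrt \<kappa>) * (\<integral>\<^sup>+ h. ennreal (G h * sqrt (Q h)) \<partial>lebesgue_fun k)"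
    by (rule nn_integral_cmult) measurable
  also have "\<dots> \<le> ennreal (sqrt (2 / pi) / sqrt \<kappa>) * ennreal (sqrt k)"
    unfolding G_def Q_def by (intro mult_left_mono nn_integral_gaussian_norm_le) simp
  also have "\<dots> = ennreal (sqrt (2 / pi) * sqrt k / sqrt \<kappa>)"
    using \<kappa> by (simp add: ennreal_mult'[symmetric])
  finally show ?thesis .
qed

section \<open>Gaussian measure and volume agree on cones up to a factor\<close>

text \<open>For a squared norm \<open>w\<close>, the condition \<open>w \<le> 2 * s\<close> says
  that the point lies in the ball of radius \<open>sqrt (2 * s)\<close>. Requiring
  \<open>0 < s\<close> keeps this radius positive for the dilation and changes the domain at most at
  the single point 0.\<close>

lemma exp_eq_nn_integral_tail:
  assumes w: "0 \<le> w"
  shows "(\<integral>\<^sup>+ s. (if 0 < s \<and> w \<le> 2 * s then ennreal (exp (- s)) else 0) \<partial>lborel) = ennreal (exp (- w / 2))"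
proof -
  have "(\<integral>\<^sup>+ s. (if 0 < s \<and> w \<le> 2 * s then ennreal (exp (- s)) else 0) \<partial>lborel) =
    (\<integral>\<^sup>+ s. ennreal (exp (- s)) * indicator {w / 2..} s \<partial>lborel)"
    by (rule nn_integral_cong_AE, rule AE_mp[OF AE_lborel_singleton[of 0]])
      (use w in \<open>auto simp: indicator_def intro!: AE_I2\<close>)
  also have "\<dots> = ennreal (0 - (- exp (- (w / 2))))"
  proof (rule nn_integral_FTC_atLeast)
    show "((\<lambda>s :: real. - exp (- s)) \<longlongrightarrow> 0) at_top"
      using tendsto_minus[OF filterlim_compose[OF exp_at_bot filterlim_uminus_at_bot_at_top]] by simp
  qed (auto intro!: derivative_eq_intros)
  finally show ?thesis by simp
qed

text \<open>The weights of the balls of radius \<open>sqrt (2 * s)\<close>, each multiplied by the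
  volume of that ball relative to the unit ball. The integral is never evaluated: taking the whole
  space as the cone shows that it is the inverse of the volume of the unit ball.\<close>

definition ball_gaussian_ratio :: "nat \<Rightarrow> ennreal" where
  "ball_gaussian_ratio k =
    (\<integral>\<^sup>+ s. (if 0 < s then ennreal ((1 / sqrt (2 * pi)) ^ k * exp (- s) * sqrt (2 * s) ^ k) else 0) \<partial>lborel)"

text \<open>The Gaussian density is a superposition of indicators of centred balls, and a cone meets
  each of these balls in a scaled copy of its part in the unit ball.\<close>

lemma gaussian_cone_eq_ball:
  fixes k :: nat and v :: "nat \<Rightarrow> real" and B :: "real \<Rightarrow> real \<Rightarrow> bool"
  assumes [measurable]: "Measurable.pred (borel \<Otimes>\<^sub>M borel) (case_prod B)"
    and cone: "\<And>c t w. 0 < c \<Longrightarrow> B (c * t) (c\<^sup>2 * w) = B t w"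
  defines "p \<equiv> \<lambda>x. \<Sum>i<k. v i * x i" and "q \<equiv> \<lambda>x :: nat \<Rightarrow> real. \<Sum>i<k. (x i)\<^sup>2"
  shows "(\<integral>\<^sup>+ x. (if B (p x) (q x) then ennreal (\<Prod>i<k. std_normal_density (x i)) else 0) \<partial>lebesgue_fun k) =
    ball_gaussian_ratio k * (\<integral>\<^sup>+ x. (if B (p x) (q x) \<and> q x \<le> 1 then 1 else 0) \<partial>lebesgue_fun k)"
proof -
  let ?C = "(1 / sqrt (2 * pi)) ^ k"
  let ?V = "\<integral>\<^sup>+ x. (if B (p x) (q x) \<and> q x \<le> 1 then 1 else 0) \<partial>lebesgue_fun k"
  have [measurable]: "p \<in> borel_measurable (lebesgue_fun k)" "q \<in> borel_measurable (lebesgue_fun k)"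
    unfolding p_def q_def by measurable
  have q: "0 \<le> q x" for x unfolding q_def by (rule sum_nonneg) simp
  have "(\<integral>\<^sup>+ x. (if B (p x) (q x) then ennreal (\<Prod>i<k. std_normal_density (x i)) else 0) \<partial>lebesgue_fun k) =
    (\<integral>\<^sup>+ x. \<integral>\<^sup>+ s. (if B (p x) (q x) \<and> 0 < s \<and> q x \<le> 2 * s then ennreal (?C * exp (- s)) else 0) \<partial>lborel \<partial>lebesgue_fun k)"
  proof (rule nn_integral_cong)
    fix x
    have "(\<integral>\<^sup>+ s. (if 0 < s \<and> q x \<le> 2 * s then ennreal (?C * exp (- s)) else 0) \<partial>lborel) =
      (\<integral>\<^sup>+ s. ennreal ?C * (if 0 < s \<and> q x \<le> 2 * s then ennreal (exp (- s)) else 0) \<partial>lborel)"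
      by (intro nn_integral_cong) (auto simp: ennreal_mult'[symmetric])
    also have "\<dots> = ennreal ?C * (\<integral>\<^sup>+ s. (if 0 < s \<and> q x \<le> 2 * s then ennreal (exp (- s)) else 0) \<partial>lborel)"
      by (rule nn_integral_cmult) measurable
    also have "\<dots> = ennreal (\<Prod>i<k. std_normal_density (x i))"
      unfolding exp_eq_nn_integral_tail[OF q] prod_std_normal_density
      by (simp add: ennreal_mult'[symmetric] q_def)
    finally show "(if B (p x) (q x) then ennreal (\<Prod>i<k. std_normal_density (x i)) else 0) =
      (\<integral>\<^sup>+ s. (if B (p x) (q x) \<and> 0 < s \<and> q x \<le> 2 * s then ennreal (?C * exp (- s)) else 0) \<partial>lborel)"
      by simp
  qed
  also have "\<dots> = (\<integral>\<^sup>+ s. \<integral>\<^sup>+ x. (if B (p x) (q x) \<and> 0 < s \<and> q x \<le> 2 * s then ennreal (?C * exp (- s)) else 0) \<partial>lebesgue_fun k \<partial>lborel)"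
    by (rule pair_sigma_finite.Fubini'[OF pair_sigma_finite_lebesgue_fun]) measurable
  also have "\<dots> = (\<integral>\<^sup>+ s. (if 0 < s then ennreal (?C * exp (- s) * sqrt (2 * s) ^ k) else 0) * ?V \<partial>lborel)"
  proof (rule nn_integral_cong)
    fix s :: real
    show "(\<integral>\<^sup>+ x. (if B (p x) (q x) \<and> 0 < s \<and> q x \<le> 2 * s then ennreal (?C * exp (- s)) else 0) \<partial>lebesgue_fun k) =
      (if 0 < s then ennreal (?C * exp (- s) * sqrt (2 * s) ^ k) else 0) * ?V"
    proof (cases "0 < s")
      case True
      define c where "c = sqrt (2 * s)"
      have c: "0 < c" "c\<^sup>2 = 2 * s" using True by (simp_all add: c_def)
      have le: "c\<^sup>2 * w \<le> 2 * s \<longleftrightarrow> w \<le> 1" for w using True c(2) by simp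
      have "(\<integral>\<^sup>+ x. (if B (p x) (q x) \<and> 0 < s \<and> q x \<le> 2 * s then ennreal (?C * exp (- s)) else 0) \<partial>lebesgue_fun k) =
        (\<integral>\<^sup>+ x. ennreal (?C * exp (- s)) * (if B (p x) (q x) \<and> q x \<le> 2 * s then 1 else 0) \<partial>lebesgue_fun k)"
        using True by (intro nn_integral_cong) auto
      also have "\<dots> = ennreal (?C * exp (- s)) * (\<integral>\<^sup>+ x. (if B (p x) (q x) \<and> q x \<le> 2 * s then 1 else 0) \<partial>lebesgue_fun k)"
        by (rule nn_integral_cmult) measurable
      also have "(\<integral>\<^sup>+ x. (if B (p x) (q x) \<and> q x \<le> 2 * s then 1 else 0) \<partial>lebesgue_fun k) =
        ennreal (c ^ k) * (\<integral>\<^sup>+ x. (if B (c * p x) (c\<^sup>2 * q x) \<and> c\<^sup>2 * q x \<le> 2 * s then 1 else 0) \<partial>lebesgue_fun k)"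
        unfolding p_def q_def
        by (rule nn_integral_scale[of "\<lambda>t w. if B t w \<and> w \<le> 2 * s then 1 else 0"]) (use c in measurable)
      \<comment> \<open>The dilation by \<open>c\<close> preserves the cone and carries the unit
        ball to the ball of radius \<open>c\<close>.\<close>
      also have "\<dots> = ennreal (c ^ k) * ?V" unfolding cone[OF c(1)] le ..
      finally show ?thesis using True c by (simp add: ennreal_mult' mult.assoc c_def)
    qed simp
  qed
  also have "\<dots> = ball_gaussian_ratio k * ?V"
    unfolding ball_gaussian_ratio_def by (rule nn_integral_multc) measurable
  finally show ?thesis .
qed

section \<open>The Gaussian and the sphere on vectors\<close>

lemma space_lborel_vec: "space (lborel_vec d) = carrier_vec d"
proof -
  have "v \<in> vec d ` (PiE {..<d} (\<lambda>_. UNIV))" if "v \<in> carrier_vec d" for v :: "real vec"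
    by (rule image_eqI[of _ _ "restrict (\<lambda>i. v $ i) {..<d}"]) (use that in \<open>auto intro!: eq_vecI\<close>)
  then show ?thesis by (auto simp: lborel_vec_def space_embed_measure space_PiM)
qed

lemma inj_on_vec: "inj_on (vec d) (space (lebesgue_fun d))"
proof (rule inj_onI)
  fix x y :: "nat \<Rightarrow> real"
  assume xy: "x \<in> space (lebesgue_fun d)" "y \<in> space (lebesgue_fun d)" and eq: "vec d x = vec d y"
  have "x i = y i" if "i < d" for i using arg_cong[OF eq, of "\<lambda>v. v $ i"] that by simp
  then show "x = y" using xy by (auto simp: space_PiM intro: PiE_ext)
qed

lemma measurable_vec [measurable]: "vec d \<in> lebesgue_fun d \<rightarrow>\<^sub>M lborel_vec d"
  unfolding lborel_vec_def by (rule measurable_embed_measure2'[OF inj_on_vec])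

lemma measurable_on_lborel_vec:
  "(\<lambda>x. g (vec d x)) \<in> lebesgue_fun d \<rightarrow>\<^sub>M N \<Longrightarrow> g \<in> lborel_vec d \<rightarrow>\<^sub>M N"
  unfolding lborel_vec_def by (rule measurable_embed_measure1)

lemma nn_integral_lborel_vec:
  "g \<in> borel_measurable (lborel_vec d) \<Longrightarrow>
    (\<integral>\<^sup>+ x. g x \<partial>lborel_vec d) = (\<integral>\<^sup>+ x. g (vec d x) \<partial>lebesgue_fun d)"
  unfolding lborel_vec_def by (rule nn_integral_embed_measure'[OF inj_on_vec])

lemma measurable_vec_index [measurable]:
  assumes "i < d"
  shows "(\<lambda>x. x $ i) \<in> borel_measurable (lborel_vec d)"
proof (rule measurable_on_lborel_vec)
  show "(\<lambda>x. vec d x $ i) \<in> borel_measurable (lebesgue_fun d)"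
    using assms measurable_component_singleton[of i "{..<d}" "\<lambda>_. lborel :: real measure"] by simp
qed

lemma measurable_into_lborel_vec:
  assumes carrier: "\<And>x. x \<in> space N \<Longrightarrow> g x \<in> carrier_vec d"
    and index: "\<And>i. i < d \<Longrightarrow> (\<lambda>x. g x $ i) \<in> borel_measurable N"
  shows "g \<in> N \<rightarrow>\<^sub>M lborel_vec d"
proof -
  have "(\<lambda>x. \<lambda>i\<in>{..<d}. g x $ i) \<in> N \<rightarrow>\<^sub>M lebesgue_fun d"
    by (rule measurable_restrict) (use index in auto)
  then have "(\<lambda>x. vec d (\<lambda>i\<in>{..<d}. g x $ i)) \<in> N \<rightarrow>\<^sub>M lborel_vec d"
    by (rule measurable_compose) (rule measurable_vec)
  moreover have "vec d (\<lambda>i\<in>{..<d}. g x $ i) = g x" if "x \<in> space N" for x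
    using carrier[OF that] by (auto intro!: eq_vecI)
  ultimately show ?thesis by (simp cong: measurable_cong)
qed

lemma measurable_scalar_prod:
  assumes f: "f \<in> N \<rightarrow>\<^sub>M lborel_vec d" and g: "g \<in> N \<rightarrow>\<^sub>M lborel_vec d"
  shows "(\<lambda>x. f x \<bullet> g x) \<in> borel_measurable N"
proof -
  have "(\<lambda>x. \<Sum>i<d. f x $ i * g x $ i) \<in> borel_measurable N"
    using measurable_compose[OF f measurable_vec_index] measurable_compose[OF g measurable_vec_index]
    by (intro borel_measurable_sum borel_measurable_times) auto
  moreover have "f x \<bullet> g x = (\<Sum>i<d. f x $ i * g x $ i)" if "x \<in> space N" for x
    using measurable_space[OF g that] by (auto simp: space_lborel_vec scalar_prod_def atLeast0LessThan)
  ultimately show ?thesis by (simp cong: measurable_cong)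
qed

lemma measurable_scalar_prod_const:
  assumes "v \<in> carrier_vec d" and "g \<in> N \<rightarrow>\<^sub>M lborel_vec d"
  shows "(\<lambda>x. v \<bullet> g x) \<in> borel_measurable N"
  by (rule measurable_scalar_prod[OF measurable_const]) (use assms in \<open>auto simp: space_lborel_vec\<close>)

lemma measurable_scalar_prod_with:
  "v \<in> carrier_vec d \<Longrightarrow> (\<lambda>x. v \<bullet> x) \<in> borel_measurable (lborel_vec d)"
  by (rule measurable_scalar_prod_const) auto

lemma measurable_scalar_prod_self: "(\<lambda>x. x \<bullet> x) \<in> borel_measurable (lborel_vec d)"
  by (rule measurable_scalar_prod[where d = d]) auto

lemma measurable_vnormalize:
  assumes f: "f \<in> N \<rightarrow>\<^sub>M lborel_vec d"
  shows "(\<lambda>x. vnormalize (f x)) \<in> N \<rightarrow>\<^sub>M lborel_vec d"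
proof (rule measurable_into_lborel_vec)
  have c: "f x \<in> carrier_vec d" if "x \<in> space N" for x
    using measurable_space[OF f that] by (simp add: space_lborel_vec)
  then show "vnormalize (f x) \<in> carrier_vec d" if "x \<in> space N" for x
    using that by (simp add: vnormalize_def)
  fix i assume i: "i < d"
  note [measurable] = measurable_scalar_prod[OF f f] measurable_compose[OF f measurable_vec_index[OF i]]
  have "(\<lambda>x. 1 / sqrt (f x \<bullet> f x) * f x $ i) \<in> borel_measurable N" by measurable
  moreover have "vnormalize (f x) $ i = 1 / sqrt (f x \<bullet> f x) * f x $ i" if "x \<in> space N" for x
    using c[OF that] i by (auto simp: vnormalize_def vnorm_def)
  ultimately show "(\<lambda>x. vnormalize (f x) $ i) \<in> borel_measurable N" by (simp cong: measurable_cong)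
qed

lemma measurable_mult_mat_vec:
  assumes M: "M \<in> carrier_mat d d" and f: "f \<in> N \<rightarrow>\<^sub>M lborel_vec d"
  shows "(\<lambda>x. M *\<^sub>v f x) \<in> N \<rightarrow>\<^sub>M lborel_vec d"
proof (rule measurable_into_lborel_vec)
  show "M *\<^sub>v f x \<in> carrier_vec d" for x
    by (rule carrier_vecI) (use M in simp)
  fix i assume i: "i < d"
  then have "row M i \<in> carrier_vec d" using M by auto
  from measurable_scalar_prod_const[OF this f] show "(\<lambda>x. (M *\<^sub>v f x) $ i) \<in> borel_measurable N"
    using i M by simp
qed

lemma measurable_power_iterate:
  assumes "M \<in> carrier_mat d d"
  shows "power_iterate M q \<in> lborel_vec d \<rightarrow>\<^sub>M lborel_vec d"
  by (induction q)
    (auto intro!: measurable_vnormalize measurable_mult_mat_vec[OF assms] simp: power_iterate.simps[abs_def])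

lemma scalar_prod_vec:
  fixes v :: "real vec"
  assumes "v \<in> carrier_vec d"
  shows "v \<bullet> vec d x = (\<Sum>i<d. v $ i * x i)" "vec d x \<bullet> vec d x = (\<Sum>i<d. (x i)\<^sup>2)"
  by (simp_all add: scalar_prod_def atLeast0LessThan power2_eq_square)

lemma sets_std_gaussian [measurable_cong]: "sets (std_gaussian d) = sets (lborel_vec d)"
  by (simp add: std_gaussian_def)

lemma space_std_gaussian: "space (std_gaussian d) = carrier_vec d"
  by (simp add: std_gaussian_def space_lborel_vec)

lemma emeasure_std_gaussian:
  assumes [measurable]: "Measurable.pred (lborel_vec d) P"
  shows "emeasure (std_gaussian d) {x \<in> carrier_vec d. P x} =
    (\<integral>\<^sup>+ x. (if P (vec d x) then ennreal (\<Prod>i<d. std_normal_density (x i)) else 0) \<partial>lebesgue_fun d)"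
proof -
  have [measurable]: "(\<lambda>x. \<Prod>i<d. std_normal_density (x $ i)) \<in> borel_measurable (lborel_vec d)"
    by (intro borel_measurable_prod) simp
  have S: "{x \<in> carrier_vec d. P x} \<in> sets (lborel_vec d)"
    using predE[OF assms] by (simp add: space_lborel_vec)
  have "emeasure (std_gaussian d) {x \<in> carrier_vec d. P x} =
    (\<integral>\<^sup>+ x. ennreal (\<Prod>i<d. std_normal_density (x $ i)) * indicator {x \<in> carrier_vec d. P x} x \<partial>lborel_vec d)"
    unfolding std_gaussian_def by (rule emeasure_density) (use S in auto)
  also have "\<dots> = (\<integral>\<^sup>+ x. ennreal (\<Prod>i<d. std_normal_density (vec d x $ i)) *
      indicator {x \<in> carrier_vec d. P x} (vec d x) \<partial>lebesgue_fun d)"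
    by (rule nn_integral_lborel_vec) (use S in measurable)
  also have "\<dots> = (\<integral>\<^sup>+ x. (if P (vec d x) then ennreal (\<Prod>i<d. std_normal_density (x i)) else 0) \<partial>lebesgue_fun d)"
    by (intro nn_integral_cong) (auto simp: indicator_def)
  finally show ?thesis .
qed

lemma prob_space_std_gaussian: "prob_space (std_gaussian d)"
proof
  show "emeasure (std_gaussian d) (space (std_gaussian d)) = 1"
    using emeasure_std_gaussian[where P = "\<lambda>_. True" and d = d] by (simp add: space_std_gaussian nn_integral_gaussian_fun)
qed

text \<open>Normalization maps neither into nor out of a cone, so the cone is its own preimage and
  its measure on the sphere is its share of the volume of the unit ball. Passing to the Gaussian
  multiplies both volumes by the same \<open>ball_gaussian_ratio d\<close>, which cancels.\<close>

lemma emeasure_uniform_sphere_cone: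
  assumes [measurable]: "Measurable.pred (borel \<Otimes>\<^sub>M borel) (case_prod B)"
    and cone: "\<And>c t w :: real. 0 < c \<Longrightarrow> B (c * t) (c\<^sup>2 * w) = B t w"
    and v: "v \<in> carrier_vec d"
  shows "emeasure (uniform_sphere d) {x \<in> carrier_vec d. B (v \<bullet> x) (x \<bullet> x)} =
    emeasure (std_gaussian d) {x \<in> carrier_vec d. B (v \<bullet> x) (x \<bullet> x)}"
proof -
  have [measurable]: "(\<lambda>x. v \<bullet> x) \<in> borel_measurable (lborel_vec d)" "(\<lambda>x. x \<bullet> x) \<in> borel_measurable (lborel_vec d)"
    by (rule measurable_scalar_prod_with[OF v] measurable_scalar_prod_self)+
  have [measurable]: "vnormalize \<in> lborel_vec d \<rightarrow>\<^sub>M lborel_vec d"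
    using measurable_vnormalize[of "\<lambda>x. x"] by simp
  have sets: "{x \<in> carrier_vec d. C (v \<bullet> x) (x \<bullet> x)} \<in> sets (lborel_vec d)"
    if [measurable]: "Measurable.pred (borel \<Otimes>\<^sub>M borel) (case_prod C)" for C
  proof -
    have "Measurable.pred (lborel_vec d) (\<lambda>x. C (v \<bullet> x) (x \<bullet> x))" by measurable
    from predE[OF this] show ?thesis by (simp add: space_lborel_vec)
  qed
  have B_vnormalize: "B (v \<bullet> vnormalize x) (vnormalize x \<bullet> vnormalize x) = B (v \<bullet> x) (x \<bullet> x)"
    if x: "x \<in> carrier_vec d" for x
  proof (cases "x \<bullet> x = 0")
    \<comment> \<open>Division by 0 gives 0, so \<open>vnormalize\<close> fixes the zero vector and
      both sides are \<open>B 0 0\<close>.\<close>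
    case True
    have "v \<bullet> vnormalize x = 0" using True x v by (simp add: vnormalize_def vnorm_def)
    moreover have "vnormalize x \<bullet> vnormalize x = 0" using True x by (simp add: vnormalize_def vnorm_def)
    moreover have "x = 0\<^sub>v d"
    proof -
      have "(\<Sum>i<d. (x $ i)\<^sup>2) = 0"
        using True x by (simp add: scalar_prod_def atLeast0LessThan power2_eq_square)
      then show ?thesis using x by (auto simp: sum_nonneg_eq_0_iff intro!: eq_vecI)
    qed
    ultimately show ?thesis using v by simp
  next
    case False
    have "0 \<le> x \<bullet> x" by (simp add: scalar_prod_def sum_nonneg)
    with False have pos: "0 < x \<bullet> x" by simp
    define c where "c = 1 / vnorm x"
    have "0 < c" using pos by (simp add: c_def vnorm_def)
    moreover have "v \<bullet> vnormalize x = c * (v \<bullet> x)" "vnormalize x \<bullet> vnormalize x = c\<^sup>2 * (x \<bullet> x)"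
      using x v by (simp_all add: vnormalize_def c_def[symmetric] power2_eq_square)
    ultimately show ?thesis by (simp add: cone)
  qed
  define U where "U = {x \<in> carrier_vec d. vnorm x \<le> 1}"
  \<comment> \<open>\<open>True\<close> stands in the place of the cone condition: the unit ball is
    the case of the whole space in the formulas below.\<close>
  have U_eq: "U = {x \<in> carrier_vec d. True \<and> x \<bullet> x \<le> 1}"
    by (auto simp: U_def vnorm_def)
  have volume: "emeasure (lborel_vec d) {x \<in> carrier_vec d. C (v \<bullet> x) (x \<bullet> x) \<and> x \<bullet> x \<le> 1} =
    (\<integral>\<^sup>+ x. (if C (\<Sum>i<d. v $ i * x i) (\<Sum>i<d. (x i)\<^sup>2) \<and> (\<Sum>i<d. (x i)\<^sup>2) \<le> 1 then 1 else 0) \<partial>lebesgue_fun d)"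
    if [measurable]: "Measurable.pred (borel \<Otimes>\<^sub>M borel) (case_prod C)" for C
  proof -
    let ?S = "{x \<in> carrier_vec d. C (v \<bullet> x) (x \<bullet> x) \<and> x \<bullet> x \<le> 1}"
    have S: "?S \<in> sets (lborel_vec d)" by (rule sets[of "\<lambda>t w. C t w \<and> w \<le> 1"]) measurable
    have "emeasure (lborel_vec d) ?S = (\<integral>\<^sup>+ x. indicator ?S x \<partial>lborel_vec d)"
      using S by simp
    also have "\<dots> = (\<integral>\<^sup>+ x. indicator ?S (vec d x) \<partial>lebesgue_fun d)"
      by (rule nn_integral_lborel_vec) (use S in measurable)
    also have "\<dots> = (\<integral>\<^sup>+ x. (if C (\<Sum>i<d. v $ i * x i) (\<Sum>i<d. (x i)\<^sup>2) \<and> (\<Sum>i<d. (x i)\<^sup>2) \<le> 1 then 1 else 0) \<partial>lebesgue_fun d)"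
      by (intro nn_integral_cong) (auto simp: indicator_def scalar_prod_vec[OF v])
    finally show ?thesis .
  qed
  have gauss: "emeasure (std_gaussian d) {x \<in> carrier_vec d. C (v \<bullet> x) (x \<bullet> x)} =
    ball_gaussian_ratio d * emeasure (lborel_vec d) {x \<in> carrier_vec d. C (v \<bullet> x) (x \<bullet> x) \<and> x \<bullet> x \<le> 1}"
    if [measurable]: "Measurable.pred (borel \<Otimes>\<^sub>M borel) (case_prod C)"
      and "\<And>c t w :: real. 0 < c \<Longrightarrow> C (c * t) (c\<^sup>2 * w) = C t w" for C
  proof -
    have "emeasure (std_gaussian d) {x \<in> carrier_vec d. C (v \<bullet> x) (x \<bullet> x)} =
      (\<integral>\<^sup>+ x. (if C (v \<bullet> vec d x) (vec d x \<bullet> vec d x)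
        then ennreal (\<Prod>i<d. std_normal_density (x i)) else 0) \<partial>lebesgue_fun d)"
      by (rule emeasure_std_gaussian) measurable
    then show ?thesis
      unfolding volume[OF that(1)] scalar_prod_vec[OF v]
      using gaussian_cone_eq_ball[OF that, where v = "\<lambda>i. v $ i" and k = d] by simp
  qed
  let ?S = "{x \<in> carrier_vec d. B (v \<bullet> x) (x \<bullet> x)}"
  let ?K = "ball_gaussian_ratio d" and ?a = "emeasure (lborel_vec d) U"
  have S: "?S \<in> sets (lborel_vec d)" by (rule sets) measurable
  have U: "U \<in> sets (lborel_vec d)" unfolding U_eq by (rule sets[of "\<lambda>t w. True \<and> w \<le> 1"]) measurable
  \<comment> \<open>The whole space is a cone of Gaussian measure 1. This also shows that
    \<open>?K\<close> is neither 0 nor \<top>, so that it cancels in the quotient below.\<close>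
  have one: "?K * ?a = 1"
    using gauss[of "\<lambda>_ _. True"] prob_space.emeasure_space_1[OF prob_space_std_gaussian, of d]
    unfolding U_eq by (simp add: space_std_gaussian)
  have K: "?K \<noteq> 0" "?K \<noteq> \<top>"
    using one by (auto simp: ennreal_top_mult ennreal_mult_top split: if_splits)
  have "emeasure (uniform_sphere d) ?S = emeasure (uniform_measure (lborel_vec d) U) (vnormalize -` ?S \<inter> carrier_vec d)"
    unfolding uniform_sphere_def U_def[symmetric]
    by (subst emeasure_distr) (use S in \<open>auto simp: space_lborel_vec\<close>)
  also have "vnormalize -` ?S \<inter> carrier_vec d = ?S"
    using B_vnormalize by (auto simp: vnormalize_def)
  also have "emeasure (uniform_measure (lborel_vec d) U) ?S = emeasure (lborel_vec d) (U \<inter> ?S) / ?a"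
    by (rule emeasure_uniform_measure[OF U S])
  also have "U \<inter> ?S = {x \<in> carrier_vec d. B (v \<bullet> x) (x \<bullet> x) \<and> x \<bullet> x \<le> 1}"
    unfolding U_eq by auto
  also have "emeasure (lborel_vec d) \<dots> / ?a = (?K * emeasure (lborel_vec d) \<dots>) / (?K * ?a)"
    using divide_mult_eq[of ?K _ ?a] K by (simp add: mult.commute[of _ ?K])
  also have "\<dots> = emeasure (std_gaussian d) ?S"
    using gauss[OF assms(1) cone] one mult_divide_eq_ennreal[of 1] by simp
  finally show ?thesis .
qed

text \<open>With \<open>c\<close> the cosine, the squared tangent is
  \<open>(1 - c\<^sup>2) / c\<^sup>2\<close>. Clearing denominators gives a condition that is
  homogeneous in \<open>x\<close> and free of \<open>arccos\<close>. If
  \<open>v \<bullet> x = 0\<close>, in particular for the zero vector where 0 / 0 is 0, the angle is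
  \<open>pi / 2\<close> and both sides fail.\<close>

lemma line_angle_cone:
  assumes v: "v \<in> carrier_vec d" "vnorm v = 1" and x: "x \<in> carrier_vec d"
  shows "line_angle v x \<noteq> pi / 2 \<and> (tan (line_angle v x))\<^sup>2 \<le> \<kappa> \<longleftrightarrow>
    v \<bullet> x \<noteq> 0 \<and> x \<bullet> x - (v \<bullet> x)\<^sup>2 \<le> \<kappa> * (v \<bullet> x)\<^sup>2"
proof (cases "v \<bullet> x = 0")
  case True
  then show ?thesis by (simp add: line_angle_def)
next
  case False
  have vv: "v \<bullet> v = 1" using v(2) by (simp add: vnorm_def)
  have cs: "(v \<bullet> x)\<^sup>2 \<le> x \<bullet> x"
    using Cauchy_Schwarz_ineq_sum[of "\<lambda>i. v $ i" "\<lambda>i. x $ i" "{0..<d}"] v x vv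
    by (simp add: scalar_prod_def power2_eq_square)
  have pos: "0 < (v \<bullet> x)\<^sup>2" using False by simp
  with cs have xx: "0 < x \<bullet> x" by linarith
  define c where "c = \<bar>v \<bullet> x\<bar> / sqrt (x \<bullet> x)"
  have angle: "line_angle v x = arccos c" by (simp add: line_angle_def vv c_def vnorm_def)
  have c2: "c\<^sup>2 = (v \<bullet> x)\<^sup>2 / (x \<bullet> x)" using xx by (simp add: c_def power_divide)
  have c: "0 < c" using False xx by (simp add: c_def)
  have "c\<^sup>2 \<le> 1" using c2 cs xx by simp
  then have c1: "c \<le> 1" using c by (simp add: abs_square_le_1)
  have "arccos c \<noteq> pi / 2"
  proof
    assume "arccos c = pi / 2"
    then have "cos (arccos c) = 0" by (simp only: cos_pi_half)
    then show False using c c1 by simp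
  qed
  moreover have "(tan (arccos c))\<^sup>2 = (1 - c\<^sup>2) / c\<^sup>2"
    using c c1 \<open>c\<^sup>2 \<le> 1\<close> by (simp add: tan_def sin_arccos power_divide)
  moreover have "(1 - c\<^sup>2) / c\<^sup>2 = (x \<bullet> x - (v \<bullet> x)\<^sup>2) / (v \<bullet> x)\<^sup>2"
    using xx pos by (simp add: c2 field_simps)
  ultimately show ?thesis using False pos by (simp add: angle divide_le_eq)
qed

lemma pred_cone:
  "Measurable.pred (borel \<Otimes>\<^sub>M borel) (\<lambda>(t, w :: real). t \<noteq> 0 \<and> w - t\<^sup>2 \<le> \<kappa> * t\<^sup>2)"
  by measurable

text \<open>Serves in both directions: the existence of a constant is proved for the Gaussian and
  carried to the sphere, while an assumed \<open>angle_constant c\<close> is carried from the sphere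
  to the Gaussian draw.\<close>

lemma measure_uniform_sphere_line_angle:
  assumes v: "v \<in> carrier_vec d" "vnorm v = 1"
  shows "\<P>(x in uniform_sphere d. line_angle v x \<noteq> pi / 2 \<and> (tan (line_angle v x))\<^sup>2 \<le> \<kappa>) =
    \<P>(x in std_gaussian d. v \<bullet> x \<noteq> 0 \<and> x \<bullet> x - (v \<bullet> x)\<^sup>2 \<le> \<kappa> * (v \<bullet> x)\<^sup>2)"
proof -
  have "{x \<in> space (uniform_sphere d). line_angle v x \<noteq> pi / 2 \<and> (tan (line_angle v x))\<^sup>2 \<le> \<kappa>} =
    {x \<in> carrier_vec d. v \<bullet> x \<noteq> 0 \<and> x \<bullet> x - (v \<bullet> x)\<^sup>2 \<le> \<kappa> * (v \<bullet> x)\<^sup>2}"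
    using line_angle_cone[OF v] by (auto simp: uniform_sphere_def space_lborel_vec)
  moreover have "c * t \<noteq> 0 \<and> c\<^sup>2 * w - (c * t)\<^sup>2 \<le> \<kappa> * (c * t)\<^sup>2 \<longleftrightarrow> t \<noteq> 0 \<and> w - t\<^sup>2 \<le> \<kappa> * t\<^sup>2"
    if "0 < c" for c t w :: real
  proof -
    have "c\<^sup>2 * w - (c * t)\<^sup>2 \<le> \<kappa> * (c * t)\<^sup>2 \<longleftrightarrow> c\<^sup>2 * (w - t\<^sup>2) \<le> c\<^sup>2 * (\<kappa> * t\<^sup>2)"
      by (simp add: power_mult_distrib algebra_simps)
    then show ?thesis using that by simp
  qed
  ultimately show ?thesis
    using emeasure_uniform_sphere_cone[OF pred_cone _ v(1), of \<kappa>]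
    by (simp add: measure_def space_std_gaussian)
qed

lemma angle_constant_824: "angle_constant 0.824"
  unfolding angle_constant_def
proof (intro allI impI ballI)
  fix d :: nat and \<delta> :: real and v :: "real vec"
  assume d: "2 \<le> d" and \<delta>: "\<delta> \<in> {0<..<1}" and v: "v \<in> carrier_vec d" "vnorm v = 1"
  define c :: real where "c = 0.824"
  define \<kappa> where "\<kappa> = c\<^sup>2 * d / \<delta>\<^sup>2"
  have c: "0 < c" and \<kappa>: "0 < \<kappa>" using d \<delta> by (auto simp: c_def \<kappa>_def)
  obtain k where k: "d = Suc k" using d by (cases d) auto
  have "(\<Sum>i<Suc k. (v $ i)\<^sup>2) = v \<bullet> v"
    using v(1) k by (simp add: scalar_prod_def atLeast0LessThan power2_eq_square del: sum.lessThan_Suc)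
  then have v2: "(\<Sum>i<Suc k. (v $ i)\<^sup>2) = 1" using v(2) by (simp add: vnorm_def)
  interpret prob_space "std_gaussian d" by (rule prob_space_std_gaussian)
  let ?P = "\<lambda>x. v \<bullet> x \<noteq> 0 \<and> x \<bullet> x - (v \<bullet> x)\<^sup>2 \<le> \<kappa> * (v \<bullet> x)\<^sup>2"
  have [measurable]: "(\<lambda>x. v \<bullet> x) \<in> borel_measurable (lborel_vec d)" "(\<lambda>x. x \<bullet> x) \<in> borel_measurable (lborel_vec d)"
    by (rule measurable_scalar_prod_with[OF v(1)] measurable_scalar_prod_self)+
  have "emeasure (std_gaussian d) {x \<in> carrier_vec d. \<not> ?P x} =
    (\<integral>\<^sup>+ x. (if \<not> ?P (vec d x) then ennreal (\<Prod>i<d. std_normal_density (x i)) else 0) \<partial>lebesgue_fun d)"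
    by (rule emeasure_std_gaussian) measurable
  also have "\<dots> = (\<integral>\<^sup>+ x. (if ?P (vec d x) then 0 else ennreal (\<Prod>i<d. std_normal_density (x i))) \<partial>lebesgue_fun d)"
    by (intro nn_integral_cong) simp
  also have "\<dots> \<le> ennreal (sqrt (2 / pi) * sqrt k / sqrt \<kappa>)"
    unfolding scalar_prod_vec[OF v(1)] unfolding k by (rule gaussian_cone_complement_le[OF v2 \<kappa>])
  also have "sqrt (2 / pi) * sqrt k / sqrt \<kappa> \<le> \<delta>"
  proof -
    have "sqrt (2 / pi) \<le> c"
    proof (rule real_le_lsqrt)
      \<comment> \<open>The crude \<open>pi > 3\<close> is enough: \<open>c\<^sup>2\<close> is
        0.678976, which exceeds 2/3.\<close>
      have "2 / pi \<le> 2 / 3" using pi_gt3 by (intro divide_left_mono) auto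
      then show "2 / pi \<le> c\<^sup>2" by (simp add: c_def power2_eq_square)
    qed (use c in auto)
    then have "sqrt (2 / pi) * sqrt k \<le> c * sqrt d"
      using c k by (intro mult_mono) auto
    also have "c * sqrt d = \<delta> * sqrt \<kappa>"
      using c \<delta> by (simp add: \<kappa>_def real_sqrt_mult real_sqrt_divide)
    finally show ?thesis using \<kappa> by (simp add: pos_divide_le_eq)
  qed
  finally have "emeasure (std_gaussian d) {x \<in> carrier_vec d. \<not> ?P x} \<le> ennreal \<delta>"
    using ennreal_leI by (meson order_trans)
  then have "prob {x \<in> space (std_gaussian d). \<not> ?P x} \<le> \<delta>"
    using \<delta> by (simp add: emeasure_eq_measure space_std_gaussian)
  moreover have "prob {x \<in> space (std_gaussian d). \<not> ?P x} = 1 - prob {x \<in> space (std_gaussian d). ?P x}"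
    by (rule prob_neg) measurable
  ultimately show "\<P>(x in uniform_sphere d. line_angle v x \<noteq> pi / 2 \<and>
      (tan (line_angle v x))\<^sup>2 \<le> 0.824\<^sup>2 * real d / \<delta>\<^sup>2) \<ge> 1 - \<delta>"
    unfolding measure_uniform_sphere_line_angle[OF v] \<kappa>_def c_def by simp
qed

section \<open>The deterministic bound on a cone, and the conclusion\<close>

text \<open>Confines all randomness to a cone condition. The vector \<open>v\<close> is fixed before
  \<open>x\<close> and \<open>\<kappa>\<close>, as \<open>angle_constant\<close> demands of its unit
  vector.\<close>

lemma TDep_minus_pow_le:
  assumes d: "d = n * p" "2 \<le> d" and spd: "T_SPD n p A"
    and ev: "T_eigenvalues n p A = image_mset l (mset_set {1..d})"
    and gap: "l 1 > l 2" and desc: "\<forall>i\<in>{2..<d}. l i \<ge> l (i + 1)" and pos: "l d > 0"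
  shows "\<exists>v\<in>carrier_vec d. vnorm v = 1 \<and> (\<forall>x\<in>carrier_vec d. \<forall>\<kappa>.
    v \<bullet> x \<noteq> 0 \<and> x \<bullet> x - (v \<bullet> x)\<^sup>2 \<le> \<kappa> * (v \<bullet> x)\<^sup>2 \<longrightarrow>
    lambda_TDep d l - lambda_pow n p A q x
      \<le> (spec_sd d l * sqrt (real d - 1) - spec_sd d l / sqrt (real d - 1))
        + \<kappa> * l 1 * (l 2 / l 1) ^ (2 * q))"
proof -
  let ?M = "bcirc n p A"
  have M: "?M \<in> carrier_mat d d" by (simp add: bcirc_def d(1))
  have sym: "?M\<^sup>T = ?M" using spd by (simp add: T_SPD_def sym_pos_def_def)
  \<comment> \<open>Eigenvalues are numbered from 1 and basis vectors from 0, so \<open>l 1\<close>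
    is entry 0 of \<open>es\<close>.\<close>
  define es where "es = map l [1..<Suc d]"
  have es: "es ! i = l (Suc i)" if "i < d" for i using that unfolding es_def by (simp del: upt_Suc)
  have "mset es = image_mset l (mset_set {1..d})"
    unfolding es_def mset_map mset_upt by (simp only: atLeastLessThanSuc_atLeastAtMost)
  then have "proots (char_poly ?M) = mset es" using ev by (simp add: T_eigenvalues_def)
  moreover have "length es = d" by (simp add: es_def)
  ultimately obtain u where u: "orthonormal_eigenbasis d ?M u (\<lambda>i. es ! i)"
    using symmetric_has_orthonormal_eigenbasis[OF M sym] by blast
  interpret orthonormal_eigenbasis d ?M u "\<lambda>i. es ! i" by (rule u)
  have le2: "l i \<le> l 2" if "2 \<le> i" "i \<le> d" for i
    using that
  proof (induction i rule: dec_induct)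
    case (step i)
    then have "l (i + 1) \<le> l i" using desc by auto
    then show ?case using step by simp
  qed simp
  have ged: "l d \<le> l i" if "2 \<le> i" "i \<le> d" for i
    using that(2) that(1)
  proof (induction i rule: inc_induct)
    case (step i)
    then have "l (i + 1) \<le> l i" using desc by auto
    then show ?case using step by simp
  qed simp
  have l2: "0 < l 2" using ged[of 2] d(2) pos by simp
  have lpos: "0 < es ! i" if "i < d" for i
  proof (cases i)
    case 0
    then show ?thesis using es[OF that] gap l2 by simp
  next
    case (Suc j)
    then show ?thesis using es[OF that] ged[of "Suc i"] pos that by simp
  qed
  have d0: "0 < d" using d(2) by simp
  show ?thesis
  proof (intro bexI conjI ballI allI impI)
    show "u 0 \<in> carrier_vec d" by (rule u[OF d0])
    show "vnorm (u 0) = 1" using u_unit[OF d0] by (simp add: vnorm_def)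
    fix x \<kappa> assume x: "x \<in> carrier_vec d"
      and H: "u 0 \<bullet> x \<noteq> 0 \<and> x \<bullet> x - (u 0 \<bullet> x)\<^sup>2 \<le> \<kappa> * (u 0 \<bullet> x)\<^sup>2"
    have l1: "es ! 0 = l 1" using es[OF d0] by simp
    have "l 1 - lambda_pow n p A q x
      \<le> l 1 * (l 2 / l 1) ^ (2 * q) * ((x \<bullet> x - (u 0 \<bullet> x)\<^sup>2) / (u 0 \<bullet> x)\<^sup>2)"
      unfolding lambda_pow_def l1[symmetric]
    proof (rule rayleigh_gap[OF x lpos _ d0])
      show "es ! i \<le> l 2" if "0 < i" "i < d" for i using es[OF that(2)] le2[of "Suc i"] that by simp
    qed (use H in auto)
    also have "\<dots> \<le> l 1 * (l 2 / l 1) ^ (2 * q) * \<kappa>"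
      using H gap l2 by (intro mult_left_mono) (auto simp: divide_le_eq)
    finally have "l 1 - lambda_pow n p A q x \<le> \<kappa> * l 1 * (l 2 / l 1) ^ (2 * q)"
      by (simp add: mult_ac)
    moreover have "spec_mean d l + spec_sd d l / sqrt (real d - 1) \<le> l 1"
    proof (rule spec_mean_plus_sd_le_max[OF d(2)])
      fix i assume "i \<in> {1..d}"
      then consider "i = 1" | "2 \<le> i" "i \<le> d" by fastforce
      then show "l i \<le> l 1" using le2[of i] gap by cases auto
    qed
    \<comment> \<open>\<open>lambda_TDep d l\<close> is the quantity in Samuelson's inequality plus
      the bracketed difference, so the two bounds through \<open>l 1\<close> add up.\<close>
    ultimately show "lambda_TDep d l - lambda_pow n p A q x
      \<le> (spec_sd d l * sqrt (real d - 1) - spec_sd d l / sqrt (real d - 1))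
        + \<kappa> * l 1 * (l 2 / l 1) ^ (2 * q)"
      unfolding lambda_TDep_def by linarith
  qed
qed

text \<open>The first conjunct keeps the second from being vacuous; the second covers every
  admissible constant, as the choice of \<open>c\<close> is left free.\<close>

theorem corollary5p3:
  shows "(\<exists>c. 0 < c \<and> c \<le> 0.824 \<and> angle_constant c) \<and>
    (\<forall>c. 0 < c \<and> c \<le> 0.824 \<and> angle_constant c \<longrightarrow>
      (\<forall>(n :: nat) (p :: nat) (A :: nat \<Rightarrow> real mat) (d :: nat) (l :: nat \<Rightarrow> real) (\<gamma> :: real)
          (q :: nat) (\<delta> :: real).
        d = n * p \<and> d \<ge> 2 \<and> T_SPD n p A \<and>
        T_eigenvalues n p A = image_mset l (mset_set {1..d}) \<and>
        l 1 > l 2 \<and> (\<forall>i\<in>{2..<d}. l i \<ge> l (i + 1)) \<and> l d > 0 \<and>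
        \<gamma> = 1 - l 2 / l 1 \<and> q \<ge> 1 \<and> 0 < \<delta> \<and> \<delta> < 1 \<longrightarrow>
        \<P>(x in std_gaussian d.
            lambda_TDep d l - lambda_pow n p A q x
            \<le> (spec_sd d l * sqrt (real d - 1) - spec_sd d l / sqrt (real d - 1))
              + c\<^sup>2 * real d * l 1 / \<delta>\<^sup>2 * (1 - \<gamma>) ^ (2 * q)) \<ge> 1 - \<delta>))"
proof (intro conjI allI impI)
  show "\<exists>c. 0 < c \<and> c \<le> 0.824 \<and> angle_constant c"
    by (intro exI[of _ "0.824"] conjI angle_constant_824) simp_all
next
  fix c :: real and n p :: nat and A :: "nat \<Rightarrow> real mat" and d :: nat and l :: "nat \<Rightarrow> real"
    and \<gamma> :: real and q :: nat and \<delta> :: real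
  assume c: "0 < c \<and> c \<le> 0.824 \<and> angle_constant c"
  assume H: "d = n * p \<and> d \<ge> 2 \<and> T_SPD n p A \<and>
        T_eigenvalues n p A = image_mset l (mset_set {1..d}) \<and>
        l 1 > l 2 \<and> (\<forall>i\<in>{2..<d}. l i \<ge> l (i + 1)) \<and> l d > 0 \<and>
        \<gamma> = 1 - l 2 / l 1 \<and> q \<ge> 1 \<and> 0 < \<delta> \<and> \<delta> < 1"
  define \<kappa> where "\<kappa> = c\<^sup>2 * real d / \<delta>\<^sup>2"
  obtain v where v: "v \<in> carrier_vec d" "vnorm v = 1" and gap: "\<And>x. x \<in> carrier_vec d \<Longrightarrow>
    v \<bullet> x \<noteq> 0 \<and> x \<bullet> x - (v \<bullet> x)\<^sup>2 \<le> \<kappa> * (v \<bullet> x)\<^sup>2 \<Longrightarrow>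
    lambda_TDep d l - lambda_pow n p A q x
      \<le> (spec_sd d l * sqrt (real d - 1) - spec_sd d l / sqrt (real d - 1))
        + \<kappa> * l 1 * (l 2 / l 1) ^ (2 * q)"
    using TDep_minus_pow_le[of d n p A l q] H by blast
  let ?E = "\<lambda>x. lambda_TDep d l - lambda_pow n p A q x
            \<le> (spec_sd d l * sqrt (real d - 1) - spec_sd d l / sqrt (real d - 1))
              + c\<^sup>2 * real d * l 1 / \<delta>\<^sup>2 * (1 - \<gamma>) ^ (2 * q)"
  let ?P = "\<lambda>x. v \<bullet> x \<noteq> 0 \<and> x \<bullet> x - (v \<bullet> x)\<^sup>2 \<le> \<kappa> * (v \<bullet> x)\<^sup>2"
  have rhs: "\<kappa> * l 1 * (l 2 / l 1) ^ (2 * q) = c\<^sup>2 * real d * l 1 / \<delta>\<^sup>2 * (1 - \<gamma>) ^ (2 * q)"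
    using H by (simp add: \<kappa>_def)
  have M: "bcirc n p A \<in> carrier_mat d d" using H by (simp add: bcirc_def)
  interpret prob_space "std_gaussian d" by (rule prob_space_std_gaussian)
  \<comment> \<open>The final comparison of probabilities by monotonicity needs the larger event to
    be measurable, hence this fact on the output of the iteration.\<close>
  have [measurable]: "lambda_pow n p A q \<in> borel_measurable (lborel_vec d)"
    unfolding lambda_pow_def[abs_def]
    by (intro measurable_scalar_prod[where d = d] measurable_mult_mat_vec[OF M] measurable_power_iterate[OF M])
  have "1 - \<delta> \<le> \<P>(x in std_gaussian d. ?P x)"
    using c H v unfolding angle_constant_def \<kappa>_def
    by (subst measure_uniform_sphere_line_angle[OF v, symmetric]) auto
  also have "\<dots> \<le> \<P>(x in std_gaussian d. ?E x)"
  proof (rule finite_measure_mono)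
    show "{x \<in> space (std_gaussian d). ?P x} \<subseteq> {x \<in> space (std_gaussian d). ?E x}"
      using gap unfolding rhs by (auto simp: space_std_gaussian)
    show "{x \<in> space (std_gaussian d). ?E x} \<in> events" by measurable
  qed
  finally show "\<P>(x in std_gaussian d. ?E x) \<ge> 1 - \<delta>" .
qed

end
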